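(* Let $\beta>1$ be fixed. Then, as $n\to\infty$, $$\sigma_{\beta}(F_n)=\frac{1}{n^{\beta}}\frac{2\zeta(2\beta-1)}{\zeta(2\beta)}+\sum_{1\le k<2\beta-2}C_k\frac{1}{n^{\beta+k}}+\sum_{0\le k<\beta-2}C^{*}_k\frac{1}{n^{2\beta+k}}+O\!\left(\frac{\log^{3\beta}n}{n^{3\beta-2}}\right),$$ where $C_k=C_k(\beta)$ and $C^{*}_k=C^{*}_k(\beta)$ are positive constants depending only on $\beta$.
   Context: Brocot sequences $F_n\subset[0,1]$ are defined inductively: $F_1=\{0/1,1/1\}$; if the elements of $F_n$ in increasing order are $0=x_{0,n}<x_{1,n}<\dots<x_{N(n),n}=1$ with $N(n)=2^{n-1}$, then $F_{n+1}=F_n\cup\{x_{i-1,n}\oplus x_{i,n}: i=1,\dots,N(n)\}$, where $\frac{p}{q}\oplus\frac{p'}{q'}=\frac{p+p'}{q+q'}$ (mediant of fractions in lowest terms). Let $p_{i,n}=x_{i,n}-x_{i-1,n}$, $i=1,\dots,N(n)$, and $\sigma_\beta(F_n)=\sum_{i=1}^{N(n)}p_{i,n}^{\beta}$. $\zeta$ is the Riemann zeta function. The implied constant in $O$ depends only on $\beta$. *)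

theory Defs
  imports Complex_Main "HOL-Library.Landau_Symbols"
begin

text \<open>\<^const>\<open>quotient_of\<close> yields numerator and (positive) denominator in lowest terms.\<close>

definition mediant :: "rat \<Rightarrow> rat \<Rightarrow> rat" where
  "mediant x y =
     Fract (fst (quotient_of x) + fst (quotient_of y)) (snd (quotient_of x) + snd (quotient_of y))"

text \<open>The sequence starts at index 1; the value at index 0 is a dummy. The elements of the
  set at index \<open>n \<ge> 1\<close> in increasing order are \<open>sorted_list_of_set (brocot n) ! i\<close> for
  \<open>i = 0, \<dots>, 2 ^ (n - 1)\<close>.\<close>

fun brocot :: "nat \<Rightarrow> rat set" where
  "brocot 0 = {}"
| "brocot (Suc 0) = {0, 1}"
| "brocot (Suc (Suc n)) = brocot (Suc n) \<union>
     {mediant (sorted_list_of_set (brocot (Suc n)) ! (i - 1))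
              (sorted_list_of_set (brocot (Suc n)) ! i) | i. 1 \<le> i \<and> i \<le> 2 ^ n}"

definition brocot_elem :: "nat \<Rightarrow> nat \<Rightarrow> real" where
  "brocot_elem i n = of_rat (sorted_list_of_set (brocot n) ! i)"

definition brocot_gap :: "nat \<Rightarrow> nat \<Rightarrow> real" where
  "brocot_gap i n = brocot_elem i n - brocot_elem (i - 1) n"

definition brocot_sigma :: "real \<Rightarrow> nat \<Rightarrow> real" where
  "brocot_sigma \<beta> n = (\<Sum>i = 1..2 ^ (n - 1). brocot_gap i n powr \<beta>)"

text \<open>The Dirichlet series of the Riemann zeta function, to be used only for \<open>s > 1\<close>.\<close>

definition zeta :: "real \<Rightarrow> real" where
  "zeta s = (\<Sum>m. 1 / real (Suc m) powr s)"

end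

theory Submission
  imports Defs "HOL-Analysis.Analysis" "HOL-Real_Asymp.Real_Asymp"
begin

text \<open>The gap between neighbours with denominators \<open>q\<close>, \<open>q'\<close> is \<open>1 / (q q')\<close>, and the pairs
  \<open>(q, q')\<close> at level \<open>n\<close> arise from \<open>(1, 1)\<close> by words of \<open>n - 1\<close> steps \<open>(x, y) \<mapsto> (x + y, y)\<close> or
  \<open>(x, y) \<mapsto> (x, x + y)\<close>. A word with a maximal block of \<open>a \<ge> n/2\<close> equal steps determines that block.
  If the block comes last, started at \<open>(u, v)\<close> after \<open>s - 1\<close> steps, then
  \<open>q q' = u\<^sup>2 (n - (s - v/u))\<close>; expanding \<open>(q q') powr - \<beta>\<close> in powers of \<open>1/n\<close> and summing over all
  \<open>(u, v)\<close> gives the terms \<open>C\<^sub>k\<close>, with \<open>C\<^sub>0\<close> evaluated by sorting all pairs \<open>v \<le> u\<close> by their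
  greatest common divisor. If the block is followed by further steps, \<open>q q'\<close> is quadratic in \<open>n\<close>, and the
  same expansion gives the terms \<open>C'\<^sub>k\<close>. All coefficients are sums of nonnegative terms. The series
  and their tails are controlled by \<open>s \<le> u\<close> and by bounding the number of \<open>v\<close> by \<open>u\<close>.

  The remaining words either have a block of at least \<open>A = n / (c log n)\<close> steps and at least about
  \<open>n/2\<close> steps outside it, which the same tail estimates cover, or have of order \<open>log n\<close> changes of
  direction. Every change doubles \<open>q q'\<close>, so the latter contribute a negligible amount because
  the gaps \<open>1 / (q q')\<close> sum to 1.\<close>

section \<open>Brocot sequences as words\<close>

definition unimodular :: "rat \<Rightarrow> rat \<Rightarrow> bool" where
  "unimodular x y \<longleftrightarrow>
     fst (quotient_of y) * snd (quotient_of x) - fst (quotient_of x) * snd (quotient_of y) = 1"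

fun refine :: "rat list \<Rightarrow> rat list" where
  "refine (x # y # zs) = x # mediant x y # refine (y # zs)"
| "refine zs = zs"

definition adjacent_sum :: "('a \<Rightarrow> 'a \<Rightarrow> real) \<Rightarrow> 'a list \<Rightarrow> real" where
  "adjacent_sum f xs = (\<Sum>i<length xs - 1. f (xs ! i) (xs ! Suc i))"

lemma quotient_of_mediant:
  assumes "unimodular x y"
  shows "quotient_of (mediant x y) =
    (fst (quotient_of x) + fst (quotient_of y), snd (quotient_of x) + snd (quotient_of y))"
proof -
  obtain p q where x: "quotient_of x = (p, q)" by fastforce
  obtain p' q' where y: "quotient_of y = (p', q')" by fastforce
  have pos: "q > 0" "q' > 0" using quotient_of_denom_pos x y by blast+
  have det: "p' * q - p * q' = 1" using assms by (simp add: unimodular_def x y)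
  have "coprime (p + p') (q + q')"
  proof (rule coprimeI)
    fix d assume "d dvd p + p'" "d dvd q + q'"
    hence "d dvd (p + p') * q - (q + q') * p" by (intro dvd_diff dvd_mult2)
    also have "(p + p') * q - (q + q') * p = 1" using det by (simp add: algebra_simps)
    finally show "is_unit d" .
  qed
  thus ?thesis using pos
    by (simp add: mediant_def x y quotient_of_Fract Rat.normalize_def coprime_iff_gcd_eq_1)
qed

lemma unimodular_mediant:
  assumes "unimodular x y"
  shows "unimodular x (mediant x y)" "unimodular (mediant x y) y"
  using assms quotient_of_mediant[OF assms] by (simp_all add: unimodular_def algebra_simps)

lemma unimodular_gap:
  assumes "unimodular x y"
  shows "y - x = 1 / (of_int (snd (quotient_of x)) * of_int (snd (quotient_of y)))"
proof -
  obtain p q where x: "quotient_of x = (p, q)" by fastforce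
  obtain p' q' where y: "quotient_of y = (p', q')" by fastforce
  have pos: "q > 0" "q' > 0" using quotient_of_denom_pos x y by blast+
  have det: "of_int p' * of_int q - of_int p * of_int q' = (1 :: rat)"
    using assms unfolding unimodular_def x y
    by (metis fst_conv snd_conv of_int_1 of_int_diff of_int_mult)
  have "x = of_int p / of_int q" "y = of_int p' / of_int q'"
    using quotient_of_div x y by blast+
  hence "y - x = (of_int p' * of_int q - of_int p * of_int q') / (of_int q * of_int q')"
    using pos by (simp add: diff_frac_eq mult.commute)
  thus ?thesis using det by (simp add: x y)
qed

lemma unimodular_imp_less:
  assumes "unimodular x y"
  shows "x < y"
proof -
  have "0 < y - x"
    unfolding unimodular_gap[OF assms]
    by (intro divide_pos_pos mult_pos_pos) (simp_all add: quotient_of_denom_pos')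
  thus ?thesis by simp
qed

lemma successively_unimodular_refine:
  "successively unimodular xs \<Longrightarrow> successively unimodular (refine xs)"
proof (induction xs rule: refine.induct)
  case (1 x y zs)
  thus ?case using unimodular_mediant[of x y] by (cases zs) auto
qed auto

lemma length_refine: "length (refine xs) = 2 * length xs - 1"
  by (induction xs rule: refine.induct) auto

lemma set_refine:
  "set (refine xs) = set xs \<union> (\<lambda>i. mediant (xs ! i) (xs ! Suc i)) ` {..<length xs - 1}"
proof (induction xs rule: refine.induct)
  case (1 x y zs)
  thus ?case by (auto simp: lessThan_Suc_eq_insert_0 image_image)
qed auto

lemma sorted_list_of_set_eqI:
  fixes xs :: "'a :: linorder list"
  assumes "sorted_wrt (<) xs" "set xs = A"
  shows "sorted_list_of_set A = xs"
  using assms by (auto simp: strict_sorted_iff sorted_list_of_set.idem_if_sorted_distinct)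

definition brocot_list :: "nat \<Rightarrow> rat list" where
  "brocot_list n = (refine ^^ n) [0, 1]"

lemma brocot_list_Suc: "brocot_list (Suc n) = refine (brocot_list n)"
  by (simp add: brocot_list_def)

lemma length_brocot_list: "length (brocot_list n) = 2 ^ n + 1"
  by (induction n) (simp_all add: brocot_list_def length_refine)

lemma successively_unimodular_brocot_list: "successively unimodular (brocot_list n)"
proof (induction n)
  case 0
  show ?case by (simp add: brocot_list_def unimodular_def)
next
  case (Suc n)
  thus ?case by (simp add: brocot_list_Suc successively_unimodular_refine)
qed

lemma sorted_wrt_brocot_list: "sorted_wrt (<) (brocot_list n)"
proof -
  have "successively (<) (brocot_list n)"
    by (rule successively_mono[OF successively_unimodular_brocot_list]) (rule unimodular_imp_less)
  thus ?thesis by (subst (asm) successively_conv_sorted_wrt) auto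
qed

lemma set_brocot_list: "set (brocot_list n) = brocot (Suc n)"
proof (induction n)
  case (Suc n)
  have "brocot (Suc (Suc n)) = set (brocot_list n) \<union>
      (\<lambda>i. mediant (brocot_list n ! (i - 1)) (brocot_list n ! i)) ` {1..2 ^ n}"
    using sorted_list_of_set_eqI[OF sorted_wrt_brocot_list Suc] Suc by auto
  also have "{1..2 ^ n} = Suc ` {..<2 ^ n}" by (simp add: image_Suc_lessThan)
  finally show ?case
    by (simp add: brocot_list_Suc set_refine length_brocot_list image_image)
qed (simp add: brocot_list_def)

lemma sorted_list_of_brocot: "sorted_list_of_set (brocot (Suc n)) = brocot_list n"
  by (rule sorted_list_of_set_eqI[OF sorted_wrt_brocot_list set_brocot_list])

lemma adjacent_sum_Cons_Cons: "adjacent_sum f (x # y # zs) = f x y + adjacent_sum f (y # zs)"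
  by (simp add: adjacent_sum_def sum.lessThan_Suc_shift del: sum.lessThan_Suc)

lemma adjacent_sum_refine:
  "adjacent_sum f (refine xs) = adjacent_sum (\<lambda>x y. f x (mediant x y) + f (mediant x y) y) xs"
proof (induction xs rule: refine.induct)
  case (1 x y zs)
  thus ?case by (cases zs) (simp_all add: adjacent_sum_Cons_Cons)
qed (simp_all add: adjacent_sum_def)

lemma adjacent_sum_cong:
  "successively P xs \<Longrightarrow> (\<And>x y. P x y \<Longrightarrow> f x y = g x y) \<Longrightarrow> adjacent_sum f xs = adjacent_sum g xs"
  unfolding adjacent_sum_def by (intro sum.cong refl) (simp add: successively_nth)

text \<open>Words are read from the right: the head of the list is the last step.\<close>

primrec act :: "bool list \<Rightarrow> nat \<times> nat \<Rightarrow> nat \<times> nat" where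
  "act [] z = z"
| "act (b # w) z = (if b then (fst (act w z) + snd (act w z), snd (act w z))
                    else (fst (act w z), fst (act w z) + snd (act w z)))"

definition den :: "bool list \<Rightarrow> nat \<times> nat" where
  "den w = act w (1, 1)"

abbreviation lden :: "bool list \<Rightarrow> nat" where
  "lden w \<equiv> fst (den w)"

abbreviation rden :: "bool list \<Rightarrow> nat" where
  "rden w \<equiv> snd (den w)"

definition den_prod :: "bool list \<Rightarrow> real" where
  "den_prod w = real (lden w) * real (rden w)"

lemma den_simps [simp]:
  "den [] = (1, 1)"
  "den (True # w) = (lden w + rden w, rden w)"
  "den (False # w) = (lden w, lden w + rden w)"
  by (simp_all add: den_def)

lemma finite_words_length_eq [simp]: "finite {w :: bool list. length w = n}"
  using finite_lists_length_eq[of "UNIV :: bool set" n] by simp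

lemma finite_words_length_le [simp]: "finite {w :: bool list. length w \<le> n}"
  using finite_lists_length_le[of "UNIV :: bool set" n] by simp

lemma sum_words_Suc:
  fixes f :: "bool list \<Rightarrow> real"
  shows "(\<Sum>w | length w = Suc n. f w) = (\<Sum>w | length w = n. f (False # w) + f (True # w))"
proof -
  have words: "{w :: bool list. length w = Suc n} =
      (#) False ` {w. length w = n} \<union> (#) True ` {w. length w = n}"
    by (auto simp: length_Suc_conv image_iff)
  show ?thesis unfolding words sum.distrib
    by (subst sum.union_disjoint) (auto simp: sum.reindex)
qed

lemma adjacent_sum_brocot_list:
  fixes g :: "nat \<Rightarrow> nat \<Rightarrow> real"
  defines "q \<equiv> \<lambda>x. nat (snd (quotient_of x))"
  shows "adjacent_sum (\<lambda>x y. g (q x) (q y)) (brocot_list n) =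
    (\<Sum>w | length w = n. g (lden w) (rden w))"
proof (induction n arbitrary: g)
  case 0
  show ?case by (simp add: q_def brocot_list_def adjacent_sum_def)
next
  case (Suc n)
  have "adjacent_sum (\<lambda>x y. g (q x) (q y)) (brocot_list (Suc n)) =
    adjacent_sum (\<lambda>x y. g (q x) (q (mediant x y)) + g (q (mediant x y)) (q y)) (brocot_list n)"
    by (simp add: brocot_list_Suc adjacent_sum_refine)
  also have "\<dots> = adjacent_sum (\<lambda>x y. g (q x) (q x + q y) + g (q x + q y) (q y)) (brocot_list n)"
  proof (rule adjacent_sum_cong[OF successively_unimodular_brocot_list])
    fix x y assume "unimodular x y"
    hence "q (mediant x y) = q x + q y"
      using quotient_of_denom_pos'[of x] quotient_of_denom_pos'[of y]
      by (simp add: q_def quotient_of_mediant nat_add_distrib)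
    thus "g (q x) (q (mediant x y)) + g (q (mediant x y)) (q y)
      = g (q x) (q x + q y) + g (q x + q y) (q y)" by simp
  qed
  also have "\<dots> = (\<Sum>w | length w = n. g (lden w) (lden w + rden w) + g (lden w + rden w) (rden w))"
    by (rule Suc.IH[of "\<lambda>x y. g x (x + y) + g (x + y) y"])
  finally show ?case by (simp add: sum_words_Suc)
qed

lemma brocot_sigma_eq_sum_words:
  "brocot_sigma \<beta> (Suc n) = (\<Sum>w | length w = n. den_prod w powr - \<beta>)"
proof -
  have "brocot_sigma \<beta> (Suc n) = adjacent_sum (\<lambda>x y. of_rat (y - x) powr \<beta>) (brocot_list n)"
    by (simp add: brocot_sigma_def brocot_gap_def brocot_elem_def sorted_list_of_brocot
        adjacent_sum_def length_brocot_list sum.atLeast1_atMost_eq of_rat_diff)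
  also have "\<dots> = adjacent_sum (\<lambda>x y. (real (nat (snd (quotient_of x))) *
      real (nat (snd (quotient_of y)))) powr - \<beta>) (brocot_list n)"
  proof (rule adjacent_sum_cong[OF successively_unimodular_brocot_list])
    fix x y assume "unimodular x y"
    from unimodular_gap[OF this]
    show "real_of_rat (y - x) powr \<beta> =
        (real (nat (snd (quotient_of x))) * real (nat (snd (quotient_of y)))) powr - \<beta>"
      using quotient_of_denom_pos'[of x] quotient_of_denom_pos'[of y]
      by (simp add: of_rat_divide of_rat_mult powr_minus_divide powr_divide)
  qed
  also have "\<dots> = (\<Sum>w | length w = n. den_prod w powr - \<beta>)"
    unfolding den_prod_def by (rule adjacent_sum_brocot_list[of "\<lambda>x y. (real x * real y) powr - \<beta>"])
  finally show ?thesis .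
qed

section \<open>Denominators\<close>

lemma act_append: "act (r @ w) z = act r (act w z)"
  by (induction r) auto

lemma act_linear:
  "act w (x, y) = (x * fst (act w (1, 0)) + y * fst (act w (0, 1)),
                   x * snd (act w (1, 0)) + y * snd (act w (0, 1)))"
  by (induction w) (auto simp: algebra_simps)

lemma act_map_Not: "act (map Not w) (y, x) = prod.swap (act w (x, y))"
  by (induction w) auto

lemma den_pos: "0 < lden w" "0 < rden w"
proof -
  have "0 < lden w \<and> 0 < rden w"
  proof (induction w)
    case (Cons b w)
    thus ?case by (cases b) auto
  qed simp
  thus "0 < lden w" "0 < rden w" by auto
qed

lemma act_one_zero_le: "fst (act w (1, 0)) \<le> lden w" "snd (act w (1, 0)) \<le> rden w"
  using act_linear[of w 1 1] by (simp_all add: den_def)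

lemma coprime_den: "coprime (lden w) (rden w)"
proof (induction w)
  case (Cons b w)
  thus ?case by (cases b) (auto simp: coprime_iff_gcd_eq_1)
qed simp

lemma den_Cons_eq_iff: "den (b # v) = den (c # w) \<longleftrightarrow> b = c \<and> den v = den w"
  using den_pos[of v] den_pos[of w] by (cases b; cases c) (auto simp: prod_eq_iff)

lemma den_Cons_neq: "den (b # w) \<noteq> (1, 1)"
  using den_pos[of w] by (cases b) auto

lemma inj_den: "inj den"
proof (rule injI)
  show "den v = den w \<Longrightarrow> v = w" for v w
  proof (induction v arbitrary: w)
    case Nil
    thus ?case using den_Cons_neq by (cases w) (force simp del: den_simps(2,3))+
  next
    case (Cons b v)
    thus ?case using den_Cons_neq[of b v]
      by (cases w) (auto simp: den_Cons_eq_iff simp del: den_simps(2,3))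
  qed
qed

lemma coprime_denE:
  assumes "coprime x y" "0 < x" "0 < y"
  obtains w where "den w = (x, y)"
proof -
  have "\<exists>w. den w = (x, y)" using assms
  proof (induction "x + y" arbitrary: x y rule: less_induct)
    case less
    consider (equal) "x = y" | (less) "x < y" | (greater) "y < x" by linarith
    thus ?case
    proof cases
      case equal
      hence "den [] = (x, y)" using less.prems by simp
      thus ?thesis by blast
    next
      case less
      have "coprime x (y - x)" using less.prems(1) gcd_diff1_nat[of x y] less
        by (simp add: coprime_iff_gcd_eq_1 gcd.commute)
      then obtain w where "den w = (x, y - x)"
        using less.hyps[of x "y - x"] less.prems less by auto
      hence "den (False # w) = (x, y)" using less by simp
      thus ?thesis by blast
    next
      case greater
      have "coprime (x - y) y" using less.prems greater
        by (simp add: coprime_iff_gcd_eq_1 gcd_diff1_nat)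
      then obtain w where "den w = (x - y, y)"
        using less.hyps[of "x - y" y] less.prems greater by auto
      hence "den (True # w) = (x, y)" using greater by simp
      thus ?thesis by blast
    qed
  qed
  thus ?thesis using that by blast
qed

lemma length_less_max_den: "length w < max (lden w) (rden w)"
proof (induction w)
  case (Cons b w)
  thus ?case using den_pos[of w] by (cases b) auto
qed simp

lemma den_prod_pos: "0 < den_prod w"
  using den_pos[of w] by (simp add: den_prod_def)

lemma Suc_length_le_den_prod: "real (Suc (length w)) \<le> den_prod w"
proof -
  have "max (lden w) (rden w) \<le> lden w * rden w"
    using den_pos[of w] by (simp add: max_def)
  hence "Suc (length w) \<le> lden w * rden w"
    using length_less_max_den[of w] by linarith
  thus ?thesis unfolding den_prod_def by (metis of_nat_le_iff of_nat_mult)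
qed

lemma sum_inverse_den_prod: "(\<Sum>w | length w = n. 1 / den_prod w) = 1"
proof (induction n)
  case (Suc n)
  have "1 / den_prod (False # w) + 1 / den_prod (True # w) = 1 / den_prod w" for w
    using den_pos[of w] by (simp add: den_prod_def divide_simps)
  thus ?case using Suc by (simp add: sum_words_Suc)
qed (simp add: den_prod_def)

lemma two_power_remdups_adj_le_den_prod: "2 ^ length (remdups_adj w) \<le> 2 * den_prod w"
proof (induction w rule: remdups_adj.induct)
  case (3 x y zs)
  have "den_prod (x # y # zs) \<ge> (if x = y then 1 else 2) * den_prod (y # zs)"
    using den_pos[of zs] by (cases x; cases y) (auto simp: den_prod_def algebra_simps)
  thus ?case using 3 by (auto split: if_splits)
next
  case (2 x)
  show ?case by (cases x) (simp_all add: den_prod_def)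
qed (simp add: den_prod_def)

lemma sum_den_prod_powr_many_blocks_le:
  assumes "\<beta> \<ge> 1" "\<And>w. w \<in> S \<Longrightarrow> length w = n"
    and blocks: "\<And>w. w \<in> S \<Longrightarrow> c \<le> real (length (remdups_adj w))"
  shows "(\<Sum>w\<in>S. den_prod w powr - \<beta>) \<le> 2 powr - ((c - 1) * (\<beta> - 1))"
proof -
  have "(\<Sum>w\<in>S. den_prod w powr - \<beta>) \<le> (\<Sum>w\<in>S. 2 powr - ((c - 1) * (\<beta> - 1)) * (1 / den_prod w))"
  proof (rule sum_mono)
    fix w assume w: "w \<in> S"
    have "2 powr (c - 1) \<le> 2 powr (real (length (remdups_adj w)) - 1)" using blocks[OF w] by simp
    also have "\<dots> \<le> den_prod w"
      using two_power_remdups_adj_le_den_prod[of w] by (simp add: powr_diff powr_realpow)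
    finally have "den_prod w powr - (\<beta> - 1) \<le> (2 powr (c - 1)) powr - (\<beta> - 1)"
      using assms(1) by (intro powr_mono2') auto
    hence "den_prod w powr - (\<beta> - 1) * (1 / den_prod w)
        \<le> 2 powr - ((c - 1) * (\<beta> - 1)) * (1 / den_prod w)"
      using den_prod_pos[of w] by (intro mult_right_mono) (auto simp: powr_powr algebra_simps)
    moreover have "den_prod w powr - \<beta> = den_prod w powr - (\<beta> - 1) * (1 / den_prod w)"
      using den_prod_pos[of w] by (simp add: powr_diff powr_minus field_simps)
    ultimately show "den_prod w powr - \<beta> \<le> 2 powr - ((c - 1) * (\<beta> - 1)) * (1 / den_prod w)"
      by linarith
  qed
  also have "\<dots> = 2 powr - ((c - 1) * (\<beta> - 1)) * (\<Sum>w\<in>S. 1 / den_prod w)"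
    by (simp add: sum_distrib_left)
  also have "(\<Sum>w\<in>S. 1 / den_prod w) \<le> (\<Sum>w | length w = n. 1 / den_prod w)"
    using assms(2) den_prod_pos by (intro sum_mono2) (auto simp: less_imp_le)
  also have "\<dots> = 1" by (rule sum_inverse_den_prod)
  finally show ?thesis by (simp add: mult_left_mono)
qed

section \<open>Maximal blocks\<close>

definition maximal_block :: "'a list \<Rightarrow> 'a \<Rightarrow> 'a list \<Rightarrow> bool" where
  "maximal_block r b p \<longleftrightarrow> (r = [] \<or> last r \<noteq> b) \<and> (p = [] \<or> hd p \<noteq> b)"

lemma leading_blockE:
  assumes "w \<noteq> []"
  obtains m x q where "w = replicate m x @ q" "0 < m" "q = [] \<or> hd q \<noteq> x"
    "length (remdups_adj w) = Suc (length (remdups_adj q))"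
proof -
  obtain x w' where w: "w = x # w'" using assms by (cases w) auto
  define m where "m = length (takeWhile (\<lambda>y. y = x) w)"
  define q where "q = dropWhile (\<lambda>y. y = x) w'"
  have "takeWhile (\<lambda>y. y = x) w = replicate m x"
    unfolding m_def by (rule replicate_eqI) (auto dest: set_takeWhileD)
  hence "w = replicate m x @ q"
    using takeWhile_dropWhile_id[of "\<lambda>y. y = x" w] by (simp add: q_def w)
  moreover have "0 < m" by (simp add: m_def w)
  moreover have "q = [] \<or> hd q \<noteq> x" unfolding q_def using hd_dropWhile by blast
  moreover have "length (remdups_adj w) = Suc (length (remdups_adj q))"
    by (simp add: w remdups_adj_Cons' q_def)
  ultimately show ?thesis using that by blast
qed

text \<open>Pigeonhole: \<^term>\<open>length (remdups_adj w)\<close> is the number of maximal blocks of \<open>w\<close>.\<close>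

lemma maximal_block_exists:
  "\<exists>r a b p. w = r @ replicate a b @ p \<and> maximal_block r b p
      \<and> length w \<le> a * length (remdups_adj w)"
proof (induction w rule: length_induct)
  case (1 w)
  show ?case
  proof (cases "w = []")
    case True
    thus ?thesis by (auto simp: maximal_block_def)
  next
    case False
    then obtain m x q where w: "w = replicate m x @ q" "0 < m" and q: "q = [] \<or> hd q \<noteq> x"
      and blocks: "length (remdups_adj w) = Suc (length (remdups_adj q))"
      using leading_blockE by metis
    have "length q < length w" using w by simp
    then obtain r a b p where IH: "q = r @ replicate a b @ p" "maximal_block r b p"
      "length q \<le> a * length (remdups_adj q)" using "1.IH" by blast
    show ?thesis
    proof (cases "a \<le> m")
      case True
      hence "length w \<le> m * length (remdups_adj w)"
        using IH(3) w(1) blocks by (simp add: order_trans[OF _ mult_le_mono1])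
      hence "w = [] @ replicate m x @ q \<and> maximal_block [] x q
          \<and> length w \<le> m * length (remdups_adj w)"
        using w(1) q by (simp add: maximal_block_def)
      thus ?thesis by blast
    next
      case False
      have "hd q = b" if "r = []" using that IH(1) False by (cases a) auto
      hence "maximal_block (replicate m x @ r) b p"
        using IH q w(2) False by (cases "r = []") (auto simp: maximal_block_def)
      moreover have "length w \<le> a * length (remdups_adj w)" using IH(3) w(1) False blocks by simp
      ultimately have "w = (replicate m x @ r) @ replicate a b @ p
          \<and> maximal_block (replicate m x @ r) b p \<and> length w \<le> a * length (remdups_adj w)"
        using w(1) IH(1) by simp
      thus ?thesis by blast
    qed
  qed
qed

lemma replicate_append_eq_iff:
  assumes "p = [] \<or> hd p \<noteq> b" "q = [] \<or> hd q \<noteq> b"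
  shows "replicate a b @ p = replicate c b @ q \<longleftrightarrow> a = c \<and> p = q"
proof (induction a arbitrary: c)
  case 0
  show ?case using assms(1) by (cases c) auto
next
  case (Suc a)
  thus ?case using assms(2) by (cases c) auto
qed

lemma block_start_unique:
  assumes eq: "replicate a b @ p = us @ replicate a' b' @ p'"
    and "length us < a" "0 < a'" "us = [] \<or> last us \<noteq> b'"
  shows "us = [] \<and> b = b'"
proof -
  have "us = take (length us) (replicate a b @ p)" by (simp add: eq)
  hence us: "us = replicate (length us) b" using assms(2) by simp
  have "b' = (us @ replicate a' b' @ p') ! length us" using assms(3) by (simp add: nth_append)
  also have "\<dots> = b" unfolding eq[symmetric] using assms(2) by (simp add: nth_append)
  finally show ?thesis using us assms(4) by (metis last_replicate length_0_conv)
qed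

lemma long_block_unique:
  assumes eq: "r @ replicate a b @ p = r' @ replicate a' b' @ p'"
    and max: "maximal_block r b p" "maximal_block r' b' p'"
    and long: "length r + length p < a" "length r' + length p' < a'"
  shows "r = r' \<and> b = b' \<and> p = p'"
proof -
  have len: "length r + a + length p = length r' + a' + length p'"
    using arg_cong[OF eq, of length] by simp
  obtain us where "r = r' @ us \<and> us @ replicate a b @ p = replicate a' b' @ p' \<or>
      r @ us = r' \<and> replicate a b @ p = us @ replicate a' b' @ p'"
    using iffD1[OF append_eq_append_conv2 eq] by (elim exE)
  hence "r = r' \<and> b = b'"
  proof
    assume us: "r = r' @ us \<and> us @ replicate a b @ p = replicate a' b' @ p'"
    have "us = [] \<and> b' = b"
      by (rule block_start_unique[of a' b' p' us a b p])
        (use us len long max in \<open>auto simp: maximal_block_def\<close>)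
    thus ?thesis using us by simp
  next
    assume us: "r @ us = r' \<and> replicate a b @ p = us @ replicate a' b' @ p'"
    have "us = [] \<and> b = b'"
      by (rule block_start_unique[of a b p us a' b' p'])
        (use us len long max in \<open>auto simp: maximal_block_def\<close>)
    thus ?thesis using us by simp
  qed
  thus ?thesis using eq max replicate_append_eq_iff[of p b p' a a']
    by (auto simp: maximal_block_def)
qed

section \<open>Frames of long blocks\<close>

text \<open>What precedes, in the order of the steps, a maximal block of \<open>False\<close>.\<close>

definition starts :: "bool list set" where
  "starts = {p. p = [] \<or> hd p}"

lemma rden_le_lden: "p \<in> starts \<Longrightarrow> rden p \<le> lden p"
  by (cases p) (auto simp: starts_def)

lemma length_less_lden: "p \<in> starts \<Longrightarrow> length p < lden p"
  using rden_le_lden[of p] length_less_max_den[of p] by (simp add: max_absorb1)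

lemma den_image_starts: "den ` starts = {(u, v). coprime u v \<and> 1 \<le> v \<and> v \<le> u}"
proof (intro equalityI subsetI)
  fix z assume "z \<in> den ` starts"
  thus "z \<in> {(u, v). coprime u v \<and> 1 \<le> v \<and> v \<le> u}"
    using coprime_den rden_le_lden den_pos by (auto simp: Suc_le_eq case_prod_unfold)
next
  fix z assume "z \<in> {(u, v). coprime u v \<and> 1 \<le> v \<and> v \<le> (u :: nat)}"
  then obtain u v where z: "z = (u, v)" "coprime u v" "1 \<le> v" "v \<le> u" by auto
  then obtain w where w: "den w = (u, v)" using coprime_denE[of u v] by auto
  have "w \<in> starts"
  proof (cases w)
    case (Cons b w')
    thus ?thesis using w z(4) den_pos[of w'] by (cases b) (auto simp: starts_def)
  qed (simp add: starts_def)
  thus "z \<in> den ` starts" using w z by force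
qed

definition flip :: "bool \<Rightarrow> bool list \<Rightarrow> bool list" where
  "flip b = map (\<lambda>c. c \<noteq> b)"

lemma flip_flip [simp]: "flip b (flip b w) = w"
  by (cases b) (simp_all add: flip_def o_def)

lemma flip_eq_flip_iff [simp]: "flip b v = flip b w \<longleftrightarrow> v = w"
  by (metis flip_flip)

lemma length_flip [simp]: "length (flip b w) = length w"
  by (simp add: flip_def)

lemma flip_block: "flip b (r @ replicate a False @ p) = flip b r @ replicate a b @ flip b p"
  by (simp add: flip_def)

lemma maximal_block_flip: "maximal_block (flip b r) b (flip b p) \<longleftrightarrow> maximal_block r False p"
  by (cases b; cases "r = []"; cases "p = []")
    (auto simp: maximal_block_def flip_def last_map hd_map)

lemma den_prod_flip [simp]: "den_prod (flip b w) = den_prod w"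
proof (cases b)
  case True
  thus ?thesis using act_map_Not[of w 1 1] by (simp add: flip_def den_prod_def den_def)
qed (simp add: flip_def)

text \<open>A frame \<open>(p, r)\<close> surrounds a maximal block of \<open>False\<close> that comes, in the order of the steps,
  after \<open>p\<close> and before \<open>r\<close>. Words at level \<open>n\<close> have \<open>n - 1\<close> steps, hence the \<open>Suc\<close> in the frame
  length.\<close>

definition frames :: "(bool list \<times> bool list) set" where
  "frames = {(p, r). maximal_block r False p}"

fun frame_length :: "bool list \<times> bool list \<Rightarrow> nat" where
  "frame_length (p, r) = Suc (length p + length r)"

fun fill :: "nat \<Rightarrow> bool list \<times> bool list \<Rightarrow> bool list" where
  "fill n (p, r) = r @ replicate (n - Suc (length p + length r)) False @ p"

definition block_words :: "nat \<Rightarrow> (bool list \<times> bool list) set \<Rightarrow> bool list set" where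
  "block_words n X = (\<lambda>(b, x). flip b (fill n x)) ` (UNIV \<times> X)"

definition short_frames :: "nat \<Rightarrow> (bool list \<times> bool list) set" where
  "short_frames n = {x \<in> frames. 2 * frame_length x \<le> n}"

definition long_frames :: "real \<Rightarrow> nat \<Rightarrow> (bool list \<times> bool list) set" where
  "long_frames A n = {x \<in> frames. n < 2 * frame_length x \<and> A \<le> real (n - frame_length x)}"

lemma length_fill: "frame_length x \<le> n \<Longrightarrow> length (fill n x) = n - 1"
  by (cases x) simp

lemma finite_frame_length:
  assumes "finite {m. P m}"
  shows "finite {x. P (frame_length x)}"
proof -
  obtain M where M: "\<And>m. P m \<Longrightarrow> m \<le> M" using assms finite_nat_set_iff_bounded_le by auto
  have "{x. P (frame_length x)} \<subseteq> {p. length p \<le> M} \<times> {r. length r \<le> M}"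
    using M by fastforce
  thus ?thesis by (rule finite_subset) simp
qed

lemma finite_long_frames:
  assumes "0 < A"
  shows "finite (long_frames A n)"
proof -
  have "finite {x. frame_length x \<le> n}" by (rule finite_frame_length) simp
  thus ?thesis by (rule finite_subset[rotated]) (use assms in \<open>auto simp: long_frames_def\<close>)
qed

lemma sum_block_words_le:
  assumes "finite X"
  shows "(\<Sum>w\<in>block_words n X. den_prod w powr - \<beta>) \<le> 2 * (\<Sum>x\<in>X. den_prod (fill n x) powr - \<beta>)"
proof -
  have "(\<Sum>w\<in>block_words n X. den_prod w powr - \<beta>)
      \<le> (\<Sum>(b, x)\<in>UNIV \<times> X. den_prod (flip b (fill n x)) powr - \<beta>)"
    unfolding block_words_def using assms
    by (intro order_trans[OF sum_image_le]) (auto simp: case_prod_unfold)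
  also have "\<dots> = (\<Sum>b\<in>UNIV. \<Sum>x\<in>X. den_prod (flip b (fill n x)) powr - \<beta>)"
    by (rule sum.cartesian_product[symmetric])
  finally show ?thesis by (simp add: UNIV_bool)
qed

lemma inj_on_flip_fill_short:
  "inj_on (\<lambda>(b, x). flip b (fill n x)) (UNIV \<times> short_frames n)"
proof (rule inj_onI)
  fix y y' :: "bool \<times> bool list \<times> bool list"
  assume y: "y \<in> UNIV \<times> short_frames n" "y' \<in> UNIV \<times> short_frames n"
    and eq: "(\<lambda>(b, x). flip b (fill n x)) y = (\<lambda>(b, x). flip b (fill n x)) y'"
  obtain b p r b' p' r' where y_eq: "y = (b, p, r)" "y' = (b', p', r')" by (metis prod_cases3)
  have "flip b r = flip b' r' \<and> b = b' \<and> flip b p = flip b' p'"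
  proof (rule long_block_unique)
    show "flip b r @ replicate (n - Suc (length p + length r)) b @ flip b p =
        flip b' r' @ replicate (n - Suc (length p' + length r')) b' @ flip b' p'"
      using eq by (simp add: y_eq flip_block)
  qed (use y in \<open>auto simp: y_eq short_frames_def frames_def maximal_block_flip\<close>)
  thus "y = y'" by (auto simp: y_eq)
qed

lemma sum_block_words_short:
  "(\<Sum>w\<in>block_words n (short_frames n). den_prod w powr - \<beta>)
    = 2 * (\<Sum>x\<in>short_frames n. den_prod (fill n x) powr - \<beta>)"
proof -
  have "(\<Sum>w\<in>block_words n (short_frames n). den_prod w powr - \<beta>)
      = (\<Sum>(b, x)\<in>UNIV \<times> short_frames n. den_prod (flip b (fill n x)) powr - \<beta>)"
    using sum.reindex[OF inj_on_flip_fill_short[of n], of "\<lambda>w. den_prod w powr - \<beta>"]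
    by (simp add: block_words_def o_def case_prod_unfold)
  also have "\<dots> = (\<Sum>b\<in>UNIV. \<Sum>x\<in>short_frames n. den_prod (flip b (fill n x)) powr - \<beta>)"
    by (rule sum.cartesian_product[symmetric])
  finally show ?thesis by (simp add: UNIV_bool)
qed

lemma maximal_block_in_block_words:
  assumes w: "w = r @ replicate a b @ p" "maximal_block r b p" "length w = n - 1" and "1 \<le> n"
  obtains x where "x \<in> frames" "frame_length x + a = n" "w = flip b (fill n x)"
proof (rule that)
  let ?x = "(flip b p, flip b r)"
  show "?x \<in> frames"
    using w(2) maximal_block_flip[of b "flip b r" "flip b p"] by (simp add: frames_def)
  show len: "frame_length ?x + a = n" using w assms(4) by simp
  hence "n - Suc (length p + length r) = a" by simp
  thus "w = flip b (fill n ?x)" by (simp add: w(1) flip_block)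
qed

lemma words_not_short_subset:
  assumes A_pos: "0 < A" and n_pos: "1 \<le> n"
  shows "{w. length w = n - 1} - block_words n (short_frames n) \<subseteq>
    {w. length w = n - 1 \<and> real (n - 1) / A \<le> real (length (remdups_adj w))} \<union>
    block_words n (long_frames A n)"
proof
  fix w assume "w \<in> {w. length w = n - 1} - block_words n (short_frames n)"
  hence len: "length w = n - 1" and not_short: "w \<notin> block_words n (short_frames n)" by auto
  obtain r a b p where block: "w = r @ replicate a b @ p" "maximal_block r b p"
    "length w \<le> a * length (remdups_adj w)" using maximal_block_exists[of w] by (elim exE conjE)
  obtain x where x: "x \<in> frames" "frame_length x + a = n" "w = flip b (fill n x)"
    using maximal_block_in_block_words[OF block(1,2) len n_pos] .
  hence in_block_words: "w \<in> block_words n X" if "x \<in> X" for X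
    using that by (auto simp: block_words_def)
  show "w \<in> {w. length w = n - 1 \<and> real (n - 1) / A \<le> real (length (remdups_adj w))} \<union>
    block_words n (long_frames A n)"
  proof (cases "A \<le> real a")
    case True
    have "x \<notin> short_frames n" using not_short in_block_words by blast
    moreover have "n - frame_length x = a" using x(2) by simp
    ultimately have "x \<in> long_frames A n" using x(1) True
      by (simp add: long_frames_def short_frames_def)
    thus ?thesis using in_block_words by blast
  next
    case False
    have "real (n - 1) \<le> real a * real (length (remdups_adj w))"
      using block(3) len by (metis of_nat_le_iff of_nat_mult)
    also have "\<dots> \<le> A * real (length (remdups_adj w))"
      using False by (intro mult_right_mono) auto
    finally show ?thesis using A_pos len by (simp add: field_simps)
  qed
qed

lemma sum_Un_le:
  fixes f :: "'a \<Rightarrow> real"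
  assumes "finite A" "finite B" "\<And>x. 0 \<le> f x"
  shows "sum f (A \<union> B) \<le> sum f A + sum f B"
  using sum.union_inter[OF assms(1,2), of f] sum_nonneg[of "A \<inter> B" f] assms(3) by simp

lemma brocot_sigma_short_frames:
  assumes \<beta>_ge_1: "1 \<le> \<beta>" and n_pos: "1 \<le> n" and A_pos: "0 < A"
  shows "\<bar>brocot_sigma \<beta> n - 2 * (\<Sum>x\<in>short_frames n. den_prod (fill n x) powr - \<beta>)\<bar> \<le>
    2 powr - ((real (n - 1) / A - 1) * (\<beta> - 1)) +
    2 * (\<Sum>x\<in>long_frames A n. den_prod (fill n x) powr - \<beta>)"
proof -
  let ?f = "\<lambda>w. den_prod w powr - \<beta>" and ?W = "{w :: bool list. length w = n - 1}"
  define M :: "bool list set"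
    where "M = {w. length w = n - 1 \<and> real (n - 1) / A \<le> real (length (remdups_adj w))}"
  define L where "L = block_words n (long_frames A n)"
  define S where "S = block_words n (short_frames n)"
  have fin: "finite M" "finite L"
    using finite_long_frames[OF A_pos] finite_subset[of M ?W]
    by (auto simp: M_def L_def block_words_def)
  have "S \<subseteq> ?W" by (auto simp: S_def block_words_def short_frames_def length_fill)
  hence "brocot_sigma \<beta> n = sum ?f (?W - S) + sum ?f S"
    using brocot_sigma_eq_sum_words[of \<beta> "n - 1"] n_pos by (simp add: sum.subset_diff)
  hence "brocot_sigma \<beta> n - 2 * (\<Sum>x\<in>short_frames n. ?f (fill n x)) = sum ?f (?W - S)"
    unfolding S_def sum_block_words_short by simp
  moreover have "0 \<le> sum ?f (?W - S)" by (intro sum_nonneg) auto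
  moreover have "sum ?f (?W - S) \<le> sum ?f M + 2 * (\<Sum>x\<in>long_frames A n. ?f (fill n x))"
  proof -
    have "sum ?f (?W - S) \<le> sum ?f (M \<union> L)"
      using words_not_short_subset[OF A_pos n_pos] fin unfolding M_def L_def S_def
      by (intro sum_mono2) auto
    also have "\<dots> \<le> sum ?f M + sum ?f L" using fin by (intro sum_Un_le) auto
    also have "sum ?f L \<le> 2 * (\<Sum>x\<in>long_frames A n. ?f (fill n x))"
      unfolding L_def by (rule sum_block_words_le[OF finite_long_frames[OF A_pos]])
    finally show ?thesis by simp
  qed
  moreover have "sum ?f M \<le> 2 powr - ((real (n - 1) / A - 1) * (\<beta> - 1))"
    by (rule sum_den_prod_powr_many_blocks_le[OF \<beta>_ge_1, of _ "n - 1"]) (auto simp: M_def)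
  ultimately show ?thesis by linarith
qed

text \<open>A frame whose block comes last gives a product linear in \<open>n\<close>, all other frames give one
  quadratic in \<open>n\<close>.\<close>

fun inner_frame :: "bool list \<times> bool list \<Rightarrow> bool list \<times> bool list" where
  "inner_frame (p, r) = (p, r @ [True])"

lemma finite_inner_frames: "finite {z. frame_length (inner_frame z) \<le> n}"
  by (rule finite_subset[of _
        "{p :: bool list. length p \<le> n} \<times> {r :: bool list. length r \<le> n}"]) auto

lemma frames_eq: "frames = (\<lambda>p. (p, [])) ` starts \<union> inner_frame ` (starts \<times> UNIV)"
proof (intro equalityI subsetI)
  fix x assume "x \<in> frames"
  then obtain p r where x: "x = (p, r)" "p \<in> starts" "r = [] \<or> last r"
    by (auto simp: frames_def starts_def maximal_block_def)
  show "x \<in> (\<lambda>p. (p, [])) ` starts \<union> inner_frame ` (starts \<times> UNIV)"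
  proof (cases "r = []")
    case False
    hence "r = butlast r @ [True]" using x(3) append_butlast_last_id by metis
    hence "x = inner_frame (p, butlast r)" by (simp add: x(1))
    thus ?thesis using x(2) by blast
  qed (use x in auto)
qed (auto simp: frames_def starts_def maximal_block_def)

lemma sum_frames_split:
  fixes f :: "bool list \<times> bool list \<Rightarrow> real"
  assumes "finite {m. P m}"
  shows "(\<Sum>x | x \<in> frames \<and> P (frame_length x). f x) =
    (\<Sum>p | p \<in> starts \<and> P (Suc (length p)). f (p, [])) +
    (\<Sum>z | z \<in> starts \<times> UNIV \<and> P (frame_length (inner_frame z)). f (inner_frame z))"
proof -
  let ?final = "{p. p \<in> starts \<and> P (Suc (length p))}"
  let ?inner = "{z. z \<in> starts \<times> UNIV \<and> P (frame_length (inner_frame z))}"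
  have "{x. x \<in> frames \<and> P (frame_length x)} =
      (\<lambda>p. (p, [])) ` {p. p \<in> starts \<and> P (frame_length (p, []))} \<union> inner_frame ` ?inner"
    unfolding frames_eq by blast
  hence split: "{x. x \<in> frames \<and> P (frame_length x)} =
      (\<lambda>p. (p, [])) ` ?final \<union> inner_frame ` ?inner"
    by simp
  have "finite ((\<lambda>p. (p, [])) ` ?final \<union> inner_frame ` ?inner)"
    unfolding split[symmetric] using finite_frame_length[OF assms]
    by (rule finite_subset[rotated]) auto
  hence sum: "(\<Sum>x | x \<in> frames \<and> P (frame_length x). f x) =
      sum f ((\<lambda>p. (p, [])) ` ?final) + sum f (inner_frame ` ?inner)"
    unfolding split by (intro sum.union_disjoint) auto
  have inj: "inj_on (\<lambda>p. (p, [])) ?final" "inj_on inner_frame ?inner"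
    by (auto intro!: inj_onI)
  show ?thesis unfolding sum sum.reindex[OF inj(1)] sum.reindex[OF inj(2)] by (simp only: o_def)
qed

section \<open>Taylor expansion\<close>

definition negbin :: "real \<Rightarrow> nat \<Rightarrow> real" where
  "negbin \<beta> k = pochhammer \<beta> k / fact k"

text \<open>The homogeneous part of degree \<open>k\<close> of the Taylor series of
  \<open>(1 - x) powr - \<beta> * (1 - y) powr - \<beta>\<close>.\<close>

definition hom_part :: "real \<Rightarrow> nat \<Rightarrow> real \<Rightarrow> real \<Rightarrow> real" where
  "hom_part \<beta> k x y = (\<Sum>i\<le>k. (negbin \<beta> i * x ^ i) * (negbin \<beta> (k - i) * y ^ (k - i)))"

lemma negbin_0 [simp]: "negbin \<beta> 0 = 1"
  by (simp add: negbin_def)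

lemma negbin_pos: "\<beta> > 0 \<Longrightarrow> negbin \<beta> k > 0"
  by (simp add: negbin_def pochhammer_pos)

lemma negbin_sums:
  assumes "\<bar>x\<bar> < 1"
  shows "(\<lambda>k. negbin \<beta> k * x ^ k) sums (1 - x) powr - \<beta>"
proof -
  have "(- \<beta> gchoose k) * (- x) ^ k = negbin \<beta> k * x ^ k" for k
  proof -
    have "(- \<beta> gchoose k) * (- x) ^ k = ((- 1) ^ k * (- 1) ^ k) * (negbin \<beta> k * x ^ k)"
      by (simp add: gbinomial_pochhammer negbin_def power_minus[of x])
    also have "(- 1) ^ k * (- 1) ^ k = (1 :: real)" by (simp flip: power_add)
    finally show ?thesis by simp
  qed
  thus ?thesis using gen_binomial_real[of "- x" "- \<beta>"] assms by simp
qed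

lemma hom_part_0 [simp]: "hom_part \<beta> 0 x y = 1"
  by (simp add: hom_part_def)

lemma hom_part_scale: "hom_part \<beta> k (c * x) (c * y) = c ^ k * hom_part \<beta> k x y"
  unfolding hom_part_def sum_distrib_left
proof (rule sum.cong)
  fix i assume "i \<in> {..k}"
  hence "c ^ k = c ^ i * c ^ (k - i)" by (simp flip: power_add)
  thus "negbin \<beta> i * (c * x) ^ i * (negbin \<beta> (k - i) * (c * y) ^ (k - i)) =
    c ^ k * (negbin \<beta> i * x ^ i * (negbin \<beta> (k - i) * y ^ (k - i)))"
    by (simp add: power_mult_distrib)
qed simp

lemma hom_part_nonneg: "\<beta> > 0 \<Longrightarrow> 0 \<le> x \<Longrightarrow> 0 \<le> y \<Longrightarrow> 0 \<le> hom_part \<beta> k x y"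
  unfolding hom_part_def by (intro sum_nonneg mult_nonneg_nonneg less_imp_le[OF negbin_pos]) auto

lemma hom_part_pos:
  assumes "\<beta> > 0" "0 < x" "0 \<le> y"
  shows "0 < hom_part \<beta> k x y"
proof -
  have "0 < negbin \<beta> k * x ^ k * (negbin \<beta> (k - k) * y ^ (k - k))"
    using assms by (simp add: negbin_pos)
  also have "\<dots> \<le> hom_part \<beta> k x y"
    unfolding hom_part_def using assms
    by (intro member_le_sum mult_nonneg_nonneg less_imp_le[OF negbin_pos]) auto
  finally show ?thesis .
qed

lemma hom_part_mono:
  assumes "\<beta> > 0" "0 \<le> x" "0 \<le> y" "x \<le> x'" "y \<le> y'"
  shows "hom_part \<beta> k x y \<le> hom_part \<beta> k x' y'"
  unfolding hom_part_def using assms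
  by (intro sum_mono mult_mono mult_left_mono power_mono mult_nonneg_nonneg
      less_imp_le[OF negbin_pos]) auto

lemma hom_part_sums:
  assumes "\<bar>x\<bar> < 1" "\<bar>y\<bar> < 1" "\<beta> > 0"
  shows "(\<lambda>k. hom_part \<beta> k x y) sums ((1 - x) powr - \<beta> * (1 - y) powr - \<beta>)"
proof -
  have abs: "summable (\<lambda>k. norm (negbin \<beta> k * t ^ k))" if "\<bar>t\<bar> < 1" for t
    using sums_summable[OF negbin_sums[of "\<bar>t\<bar>" \<beta>]] that negbin_pos[OF assms(3)]
    by (simp add: abs_mult power_abs abs_of_pos)
  have "(\<lambda>k. \<Sum>i\<le>k. (negbin \<beta> i * x ^ i) * (negbin \<beta> (k - i) * y ^ (k - i))) sums
     ((\<Sum>k. negbin \<beta> k * x ^ k) * (\<Sum>k. negbin \<beta> k * y ^ k))"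
    by (rule Cauchy_product_sums) (use abs assms in auto)
  thus ?thesis unfolding hom_part_def
    using sums_unique[OF negbin_sums[OF assms(1), of \<beta>]]
      sums_unique[OF negbin_sums[OF assms(2), of \<beta>]] by simp
qed

lemma hom_part_half_sums:
  assumes "\<beta> > 0"
  shows "(\<lambda>k. hom_part \<beta> k (1/2) (1/2)) sums (4 powr \<beta>)"
proof -
  have "(1/2) powr - \<beta> * (1/2) powr - \<beta> = (4 :: real) powr \<beta>"
    by (simp add: powr_minus_divide powr_divide flip: powr_mult)
  thus ?thesis using hom_part_sums[of "1/2" "1/2" \<beta>] assms by simp
qed

lemma hom_part_le_scaled:
  assumes "\<beta> > 0" "0 \<le> x" "0 \<le> y" "x \<le> z" "y \<le> z"
  shows "hom_part \<beta> k x y \<le> (2 * z) ^ k * hom_part \<beta> k (1/2) (1/2)"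
  using hom_part_mono[OF assms, of k] hom_part_scale[of \<beta> k "2 * z" "1/2" "1/2"] by simp

lemma hom_part_half_nonneg: "\<beta> > 0 \<Longrightarrow> hom_part \<beta> k (1/2) (1/2) \<ge> 0"
  by (rule hom_part_nonneg) auto

lemma sum_hom_part_half_le:
  assumes "\<beta> > 0" "finite A"
  shows "(\<Sum>k\<in>A. hom_part \<beta> k (1/2) (1/2)) \<le> 4 powr \<beta>"
  using sum_le_suminf[OF sums_summable[OF hom_part_half_sums[OF assms(1)]] assms(2)]
    sums_unique[OF hom_part_half_sums[OF assms(1)]] hom_part_half_nonneg[OF assms(1)] by simp

lemma hom_part_le:
  assumes "\<beta> > 0" "0 \<le> x" "0 \<le> y" "x \<le> z" "y \<le> z"
  shows "hom_part \<beta> k x y \<le> 4 powr \<beta> * (2 * z) ^ k"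
proof -
  have "hom_part \<beta> k (1/2) (1/2) \<le> 4 powr \<beta>" using sum_hom_part_half_le[OF assms(1), of "{k}"]
    by simp
  hence "(2 * z) ^ k * hom_part \<beta> k (1/2) (1/2) \<le> (2 * z) ^ k * 4 powr \<beta>"
    using assms by (intro mult_left_mono) auto
  thus ?thesis using hom_part_le_scaled[OF assms, of k] by (simp add: mult.commute)
qed

lemma sum_hom_part_le:
  assumes "\<beta> > 0" "0 \<le> x" "0 \<le> y" "x \<le> z" "y \<le> z" "1/2 \<le> z" "K \<le> Suc m"
  shows "(\<Sum>k<K. hom_part \<beta> k x y) \<le> 4 powr \<beta> * (2 * z) ^ m"
proof -
  have "(\<Sum>k<K. hom_part \<beta> k x y) \<le> (\<Sum>k<K. (2 * z) ^ m * hom_part \<beta> k (1/2) (1/2))"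
  proof (rule sum_mono)
    fix k assume "k \<in> {..<K}"
    hence "(2 * z) ^ k \<le> (2 * z) ^ m" using assms by (intro power_increasing) auto
    hence "(2 * z) ^ k * hom_part \<beta> k (1/2) (1/2) \<le> (2 * z) ^ m * hom_part \<beta> k (1/2) (1/2)"
      using hom_part_half_nonneg[OF assms(1)] by (intro mult_right_mono) auto
    thus "hom_part \<beta> k x y \<le> (2 * z) ^ m * hom_part \<beta> k (1/2) (1/2)"
      using hom_part_le_scaled[OF assms(1-5), of k] by linarith
  qed
  also have "\<dots> = (2 * z) ^ m * (\<Sum>k<K. hom_part \<beta> k (1/2) (1/2))" by (simp add: sum_distrib_left)
  also have "\<dots> \<le> (2 * z) ^ m * 4 powr \<beta>"
    using assms sum_hom_part_half_le[OF assms(1)] by (intro mult_left_mono) auto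
  finally show ?thesis by (simp add: mult.commute)
qed

lemma hom_part_remainder:
  assumes "\<beta> > 0" "0 \<le> x" "0 \<le> y" "x \<le> z" "y \<le> z" "z \<le> 1/2"
  shows "\<bar>(1 - x) powr - \<beta> * (1 - y) powr - \<beta> - (\<Sum>k<K. hom_part \<beta> k x y)\<bar> \<le> 4 powr \<beta> * (2 * z) ^ K"
proof -
  have series: "(\<lambda>k. hom_part \<beta> k x y) sums ((1 - x) powr - \<beta> * (1 - y) powr - \<beta>)"
    by (rule hom_part_sums) (use assms in auto)
  have tail: "(\<lambda>k. hom_part \<beta> (k + K) x y) sums
      ((1 - x) powr - \<beta> * (1 - y) powr - \<beta> - (\<Sum>k<K. hom_part \<beta> k x y))"
    using series by (subst sums_iff_shift) simp
  have half: "(\<lambda>k. hom_part \<beta> (k + K) (1/2) (1/2)) sums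
      (4 powr \<beta> - (\<Sum>k<K. hom_part \<beta> k (1/2) (1/2)))"
    using hom_part_half_sums[OF assms(1)] by (subst sums_iff_shift) simp
  have "0 \<le> (1 - x) powr - \<beta> * (1 - y) powr - \<beta> - (\<Sum>k<K. hom_part \<beta> k x y)"
    using assms by (intro sums_le[OF _ sums_zero tail] hom_part_nonneg) auto
  moreover have "(1 - x) powr - \<beta> * (1 - y) powr - \<beta> - (\<Sum>k<K. hom_part \<beta> k x y)
      \<le> (2 * z) ^ K * (4 powr \<beta> - (\<Sum>k<K. hom_part \<beta> k (1/2) (1/2)))"
  proof (rule sums_le[OF _ tail sums_mult[OF half]])
    fix k
    have "(2 * z) ^ (k + K) \<le> (2 * z) ^ K" using assms by (intro power_decreasing) auto
    hence "(2 * z) ^ (k + K) * hom_part \<beta> (k + K) (1/2) (1/2)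
        \<le> (2 * z) ^ K * hom_part \<beta> (k + K) (1/2) (1/2)"
      using hom_part_half_nonneg[OF assms(1)] by (intro mult_right_mono) auto
    thus "hom_part \<beta> (k + K) x y \<le> (2 * z) ^ K * hom_part \<beta> (k + K) (1/2) (1/2)"
      using hom_part_le_scaled[OF assms(1-5), of "k + K"] by linarith
  qed
  moreover have "(2 * z) ^ K * (4 powr \<beta> - (\<Sum>k<K. hom_part \<beta> k (1/2) (1/2)))
      \<le> (2 * z) ^ K * 4 powr \<beta>"
    using assms by (intro mult_left_mono) (auto intro!: sum_nonneg hom_part_nonneg)
  ultimately show ?thesis by (simp add: mult.commute)
qed

definition min_power :: "nat \<Rightarrow> nat \<Rightarrow> real \<Rightarrow> real" where
  "min_power K J t = min (t ^ K) (t ^ J)"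

lemma min_power_le: "min_power K J t \<le> t ^ K" "min_power K J t \<le> t ^ J"
  by (simp_all add: min_power_def)

lemma min_power_nonneg: "0 \<le> t \<Longrightarrow> 0 \<le> min_power K J t"
  by (simp add: min_power_def)

lemma min_power_mono: "0 \<le> s \<Longrightarrow> s \<le> t \<Longrightarrow> min_power K J s \<le> min_power K J t"
  unfolding min_power_def by (intro min.mono power_mono)

lemma min_power_ge_1: "1 \<le> t \<Longrightarrow> 1 \<le> min_power K J t"
  by (simp add: min_power_def one_le_power)

text \<open>With \<open>J < K\<close> the bound is of order \<open>K\<close> for small \<open>z\<close>, while only moments of order \<open>J\<close> are
  needed to sum it.\<close>

lemma hom_part_truncation:
  assumes "\<beta> > 0" "0 \<le> x" "0 \<le> y" "x \<le> z" "y \<le> z" and "J \<le> K" "K \<le> Suc J"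
  shows "\<bar>(if 2 * z \<le> 1 then (1 - x) powr - \<beta> * (1 - y) powr - \<beta> else 0) - (\<Sum>k<K. hom_part \<beta> k x y)\<bar>
    \<le> 4 powr \<beta> * min_power K J (2 * z)"
proof (cases "2 * z \<le> 1")
  case True
  hence "(2 * z) ^ K \<le> (2 * z) ^ J" using assms by (intro power_decreasing) auto
  thus ?thesis using True hom_part_remainder[OF assms(1-5), of K] by (simp add: min_power_def)
next
  case False
  hence "(2 * z) ^ J \<le> (2 * z) ^ K" using assms by (intro power_increasing) auto
  moreover have "0 \<le> (\<Sum>k<K. hom_part \<beta> k x y)" using assms
    by (intro sum_nonneg hom_part_nonneg) auto
  ultimately show ?thesis using False sum_hom_part_le[OF assms(1-5), of K J] assms(7)
    by (simp add: min_power_def)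
qed

section \<open>Expansion of weighted sums over lags\<close>

lemma has_sum_sum:
  fixes f :: "'k \<Rightarrow> 'a \<Rightarrow> 'b :: topological_comm_monoid_add"
  assumes "finite K" "\<And>k. k \<in> K \<Longrightarrow> (f k has_sum s k) A"
  shows "((\<lambda>x. \<Sum>k\<in>K. f k x) has_sum (\<Sum>k\<in>K. s k)) A"
  using assms by (induction K rule: finite_induct) (auto intro!: has_sum_add)

lemma infsum_pos:
  fixes f :: "'a \<Rightarrow> real"
  assumes "f summable_on A" "\<And>x. x \<in> A \<Longrightarrow> 0 \<le> f x" "a \<in> A" "0 < f a"
  shows "0 < infsum f A"
  using finite_sum_le_infsum[OF assms(1), of "{a}"] assms by force

text \<open>At level \<open>n\<close> the member \<open>x\<close> of the family contributes, up to a factor,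
  \<open>weight x * ((1 - lag1 x / n) * (1 - lag2 x / n)) powr - \<beta>\<close>. The truncation error covers the
  Taylor remainder for \<open>2 * len x \<le> n\<close> and the terms of the coefficient series for all other \<open>x\<close>.\<close>

locale lag_family =
  fixes \<beta> :: real and I :: "'i set" and weight :: "'i \<Rightarrow> real" and len :: "'i \<Rightarrow> nat"
    and lag1 lag2 :: "'i \<Rightarrow> real"
  assumes weight_nonneg: "x \<in> I \<Longrightarrow> 0 \<le> weight x"
    and len_pos: "x \<in> I \<Longrightarrow> 0 < len x"
    and lag1_nonneg: "x \<in> I \<Longrightarrow> 0 \<le> lag1 x" and lag1_le: "x \<in> I \<Longrightarrow> lag1 x \<le> real (len x)"
    and lag2_nonneg: "x \<in> I \<Longrightarrow> 0 \<le> lag2 x" and lag2_le: "x \<in> I \<Longrightarrow> lag2 x \<le> real (len x)"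
begin

definition coeff :: "nat \<Rightarrow> real" where
  "coeff k = (\<Sum>\<^sub>\<infinity>x\<in>I. weight x * hom_part \<beta> k (lag1 x) (lag2 x))"

definition has_moment :: "nat \<Rightarrow> bool" where
  "has_moment J \<longleftrightarrow> (\<lambda>x. weight x * real (len x) ^ J) summable_on I"

definition truncation_error :: "nat \<Rightarrow> nat \<Rightarrow> nat \<Rightarrow> real" where
  "truncation_error K J n = (\<Sum>\<^sub>\<infinity>x\<in>I. weight x * min_power K J (2 * real (len x) / real n))"

lemma coeff_term_nonneg: "\<beta> > 0 \<Longrightarrow> x \<in> I \<Longrightarrow> 0 \<le> weight x * hom_part \<beta> k (lag1 x) (lag2 x)"
  by (intro mult_nonneg_nonneg hom_part_nonneg weight_nonneg lag1_nonneg lag2_nonneg)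

lemma summable_coeff:
  assumes "\<beta> > 0" "has_moment J" "k \<le> J"
  shows "(\<lambda>x. weight x * hom_part \<beta> k (lag1 x) (lag2 x)) summable_on I"
proof (rule summable_on_comparison_test)
  show "(\<lambda>x. (4 powr \<beta> * 2 ^ k) * (weight x * real (len x) ^ J)) summable_on I"
    using assms(2) unfolding has_moment_def by (rule summable_on_cmult_right)
  fix x assume x: "x \<in> I"
  have "hom_part \<beta> k (lag1 x) (lag2 x) \<le> 4 powr \<beta> * (2 * real (len x)) ^ k"
    by (intro hom_part_le assms lag1_nonneg lag1_le lag2_nonneg lag2_le x)
  also have "\<dots> \<le> 4 powr \<beta> * (2 ^ k * real (len x) ^ J)"
    unfolding power_mult_distrib using len_pos[OF x] assms(3)
    by (intro mult_left_mono power_increasing) auto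
  finally show "weight x * hom_part \<beta> k (lag1 x) (lag2 x)
      \<le> (4 powr \<beta> * 2 ^ k) * (weight x * real (len x) ^ J)"
    using weight_nonneg[OF x] by (auto dest: mult_left_mono simp: mult_ac)
qed (use assms coeff_term_nonneg in auto)

lemma coeff_pos:
  assumes "\<beta> > 0" "has_moment J" "k \<le> J" and "x \<in> I" "0 < weight x" "0 < lag1 x"
  shows "0 < coeff k"
  unfolding coeff_def
  using assms
  by (intro infsum_pos[of _ _ x] summable_coeff coeff_term_nonneg mult_pos_pos hom_part_pos
      lag2_nonneg)

lemma summable_truncation_error:
  assumes "has_moment J"
  shows "(\<lambda>x. weight x * min_power K J (2 * real (len x) / real n)) summable_on I"
proof (rule summable_on_comparison_test)
  show "(\<lambda>x. (2 / real n) ^ J * (weight x * real (len x) ^ J)) summable_on I"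
    using assms unfolding has_moment_def by (rule summable_on_cmult_right)
  fix x assume x: "x \<in> I"
  have "weight x * min_power K J (2 * real (len x) / real n)
      \<le> weight x * (2 * real (len x) / real n) ^ J"
    by (intro mult_left_mono min_power_le weight_nonneg x)
  thus "weight x * min_power K J (2 * real (len x) / real n)
      \<le> (2 / real n) ^ J * (weight x * real (len x) ^ J)"
    by (simp add: power_mult_distrib power_divide mult_ac)
  show "0 \<le> weight x * min_power K J (2 * real (len x) / real n)"
    by (intro mult_nonneg_nonneg weight_nonneg min_power_nonneg x) simp
qed

lemma truncation_error_nonneg: "0 \<le> truncation_error K J n"
  unfolding truncation_error_def
  by (intro infsum_nonneg mult_nonneg_nonneg weight_nonneg min_power_nonneg) auto

lemma sum_long_le_truncation_error:
  assumes "has_moment J" "1 \<le> n" "finite G" "G \<subseteq> {x \<in> I. n < 2 * len x}"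
    and c: "0 \<le> c" "\<And>x. x \<in> G \<Longrightarrow> F x \<le> c * weight x"
  shows "(\<Sum>x\<in>G. F x) \<le> c * truncation_error K J n"
proof -
  have "(\<Sum>x\<in>G. F x) \<le> (\<Sum>x\<in>G. c * (weight x * min_power K J (2 * real (len x) / real n)))"
  proof (rule sum_mono)
    fix x assume x: "x \<in> G"
    hence xI: "x \<in> I" "n < 2 * len x" using assms(4) by auto
    from xI(2) have "real n \<le> 2 * real (len x)" by linarith
    hence "1 \<le> 2 * real (len x) / real n" using assms(2) by simp
    from mult_left_mono[OF min_power_ge_1[OF this] weight_nonneg[OF xI(1)]]
    have "weight x \<le> weight x * min_power K J (2 * real (len x) / real n)"
      by (simp only: mult_1_right)
    from mult_left_mono[OF this c(1)]
    show "F x \<le> c * (weight x * min_power K J (2 * real (len x) / real n))" using c(2)[OF x]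
      by linarith
  qed
  also have "\<dots> = c * (\<Sum>x\<in>G. weight x * min_power K J (2 * real (len x) / real n))"
    by (simp add: sum_distrib_left)
  also have "\<dots> \<le> c * truncation_error K J n"
    unfolding truncation_error_def using assms weight_nonneg
    by (intro mult_left_mono finite_sum_le_infsum summable_truncation_error)
      (auto intro!: mult_nonneg_nonneg min_power_nonneg)
  finally show ?thesis .
qed

lemma truncated_term_le:
  assumes "\<beta> > 0" "J \<le> K" "K \<le> Suc J" "1 \<le> n" and x: "x \<in> I"
  shows "\<bar>weight x *
      ((if 2 * len x \<le> n then (1 - lag1 x / real n) powr - \<beta> * (1 - lag2 x / real n) powr - \<beta> else 0)
        - (\<Sum>k<K. hom_part \<beta> k (lag1 x / real n) (lag2 x / real n)))\<bar>
    \<le> 4 powr \<beta> * (weight x * min_power K J (2 * real (len x) / real n))" (is "\<bar>_ * ?d\<bar> \<le> _")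
proof -
  have "2 * len x \<le> n \<longleftrightarrow> real (2 * len x) \<le> real n" by (simp only: of_nat_le_iff)
  also have "\<dots> \<longleftrightarrow> 2 * (real (len x) / real n) \<le> 1" using assms(4) by simp
  finally have short_iff: "2 * len x \<le> n \<longleftrightarrow> 2 * (real (len x) / real n) \<le> 1" .
  have "\<bar>?d\<bar> \<le> 4 powr \<beta> * min_power K J (2 * (real (len x) / real n))"
    unfolding short_iff using lag1_nonneg[OF x] lag1_le[OF x] lag2_nonneg[OF x] lag2_le[OF x]
    by (intro hom_part_truncation assms divide_right_mono divide_nonneg_nonneg) auto
  hence "\<bar>?d\<bar> \<le> 4 powr \<beta> * min_power K J (2 * real (len x) / real n)"
    by (simp only: times_divide_eq_right)
  from mult_left_mono[OF this weight_nonneg[OF x]] show ?thesis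
    using weight_nonneg[OF x] by (simp only: abs_mult abs_of_nonneg mult.left_commute)
qed

lemma short_terms_expansion:
  assumes \<beta>_pos: "\<beta> > 0" and orders: "has_moment J" "J \<le> K" "K \<le> Suc J" and n_pos: "1 \<le> n"
    and fin: "finite {x \<in> I. 2 * len x \<le> n}"
  shows "\<bar>(\<Sum>x | x \<in> I \<and> 2 * len x \<le> n.
        weight x * ((1 - lag1 x / real n) powr - \<beta> * (1 - lag2 x / real n) powr - \<beta>))
      - (\<Sum>k<K. coeff k / real n ^ k)\<bar> \<le> 4 powr \<beta> * truncation_error K J n"
proof -
  define h where "h x = (1 - lag1 x / real n) powr - \<beta> * (1 - lag2 x / real n) powr - \<beta>" for x
  define t where "t k x = hom_part \<beta> k (lag1 x / real n) (lag2 x / real n)" for k x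
  let ?S = "{x \<in> I. 2 * len x \<le> n}" and ?e = "\<lambda>x. min_power K J (2 * real (len x) / real n)"
  have short: "((\<lambda>x. weight x * (if 2 * len x \<le> n then h x else 0))
      has_sum (\<Sum>x\<in>?S. weight x * h x)) I"
    by (rule has_sum_finite_neutralI[OF fin]) auto
  have "((\<lambda>x. weight x * t k x) has_sum coeff k / real n ^ k) I" if "k < K" for k
  proof -
    have t: "t k x = hom_part \<beta> k (lag1 x) (lag2 x) / real n ^ k" for x
      using hom_part_scale[of \<beta> k "1 / real n" "lag1 x" "lag2 x"] by (simp add: t_def power_divide)
    have "((\<lambda>x. weight x * hom_part \<beta> k (lag1 x) (lag2 x)) has_sum coeff k) I"
      unfolding coeff_def using that orders
      by (intro has_sum_infsum summable_coeff[OF \<beta>_pos orders(1)]) auto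
    from has_sum_cmult_right[OF this, of "1 / real n ^ k"] show ?thesis by (simp add: t mult_ac)
  qed
  hence "((\<lambda>x. \<Sum>k<K. weight x * t k x) has_sum (\<Sum>k<K. coeff k / real n ^ k)) I"
    by (intro has_sum_sum) auto
  from has_sum_add[OF short has_sum_uminusI[OF this]]
  have diff: "((\<lambda>x. weight x * ((if 2 * len x \<le> n then h x else 0) - (\<Sum>k<K. t k x))) has_sum
      ((\<Sum>x\<in>?S. weight x * h x) - (\<Sum>k<K. coeff k / real n ^ k))) I"
    by (simp add: right_diff_distrib sum_distrib_left)
  have error: "((\<lambda>x. 4 powr \<beta> * (weight x * ?e x)) has_sum (4 powr \<beta> * truncation_error K J n)) I"
    unfolding truncation_error_def
    by (intro has_sum_cmult_right has_sum_infsum summable_truncation_error orders)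
  have "norm (weight x * ((if 2 * len x \<le> n then h x else 0) - (\<Sum>k<K. t k x)))
      \<le> 4 powr \<beta> * (weight x * ?e x)"
    if "x \<in> I" for x
    using truncated_term_le[OF \<beta>_pos orders(2,3) n_pos that]
    by (simp only: h_def t_def real_norm_def)
  from norm_infsum_le[OF diff error this] show ?thesis by (simp add: h_def)
qed

lemma sum_short_expansion:
  assumes "\<beta> > 0" "has_moment J" "J \<le> K" "K \<le> Suc J" "1 \<le> n" "finite {x \<in> I. 2 * len x \<le> n}"
    and F: "\<And>x. x \<in> I \<Longrightarrow> len x \<le> n \<Longrightarrow> F x = real n powr - \<gamma> *
      (weight x * ((1 - lag1 x / real n) powr - \<beta> * (1 - lag2 x / real n) powr - \<beta>))"
  shows "\<bar>(\<Sum>x | x \<in> I \<and> 2 * len x \<le> n. F x) - (\<Sum>k<K. coeff k / real n powr (\<gamma> + real k))\<bar>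
    \<le> 4 powr \<beta> * (real n powr - \<gamma> * truncation_error K J n)"
proof -
  let ?h = "\<lambda>x. weight x * ((1 - lag1 x / real n) powr - \<beta> * (1 - lag2 x / real n) powr - \<beta>)"
  have "(\<Sum>x | x \<in> I \<and> 2 * len x \<le> n. F x) = real n powr - \<gamma> * (\<Sum>x | x \<in> I \<and> 2 * len x \<le> n. ?h x)"
    unfolding sum_distrib_left by (intro sum.cong refl F) auto
  moreover have "(\<Sum>k<K. coeff k / real n powr (\<gamma> + real k))
      = real n powr - \<gamma> * (\<Sum>k<K. coeff k / real n ^ k)"
    using \<open>1 \<le> n\<close> unfolding sum_distrib_left
    by (intro sum.cong) (simp_all add: powr_add powr_minus powr_realpow field_simps)
  ultimately have
    "\<bar>(\<Sum>x | x \<in> I \<and> 2 * len x \<le> n. F x) - (\<Sum>k<K. coeff k / real n powr (\<gamma> + real k))\<bar> =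
      real n powr - \<gamma> * \<bar>(\<Sum>x | x \<in> I \<and> 2 * len x \<le> n. ?h x) - (\<Sum>k<K. coeff k / real n ^ k)\<bar>"
    by (simp add: abs_mult flip: right_diff_distrib)
  also have "\<dots> \<le> real n powr - \<gamma> * (4 powr \<beta> * truncation_error K J n)"
    by (intro mult_left_mono short_terms_expansion assms) auto
  finally show ?thesis by (simp only: mult.left_commute)
qed

end

section \<open>Sums over words\<close>

lemma has_sum_product_nonneg:
  fixes f :: "'a \<Rightarrow> real" and g :: "'b \<Rightarrow> real"
  assumes f: "(f has_sum s) A" "\<And>x. x \<in> A \<Longrightarrow> 0 \<le> f x"
    and g: "(g has_sum t) B" "\<And>y. y \<in> B \<Longrightarrow> 0 \<le> g y"
  shows "((\<lambda>(x, y). f x * g y) has_sum s * t) (A \<times> B)"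
proof -
  have inner: "((\<lambda>y. case (x, y) of (x, y) \<Rightarrow> f x * g y) has_sum f x * t) B" for x
    using has_sum_cmult_right[OF g(1), of "f x"] by simp
  have outer: "((\<lambda>x. f x * t) has_sum s * t) A"
    by (rule has_sum_cmult_left[OF f(1)])
  show ?thesis
    by (rule has_sum_SigmaI[OF inner outer
          summable_on_SigmaI[OF inner has_sum_imp_summable[OF outer]]])
      (use f(2) g(2) in auto)
qed

lemma summable_on_powr_minus:
  assumes "s > 1"
  shows "(\<lambda>u. real u powr - s) summable_on UNIV"
  using summable_real_powr_iff[of "- s"] assms by (intro summable_nonneg_imp_summable_on) auto

lemma zeta_has_sum:
  assumes "s > 1"
  shows "((\<lambda>m. real m powr - s) has_sum zeta s) {1..}"
proof -
  have "summable (\<lambda>m. real (Suc m) powr - s)"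
    using summable_real_powr_iff[of "- s"] assms by (subst summable_Suc_iff) simp
  hence "(\<lambda>m. real (Suc m) powr - s) sums zeta s"
    unfolding zeta_def powr_minus_divide by (rule summable_sums)
  hence "((\<lambda>m. real (Suc m) powr - s) has_sum zeta s) UNIV"
    by (rule sums_nonneg_imp_has_sum) auto
  moreover have "range Suc = {1..}" by (auto simp: image_iff Suc_le_eq gr0_conv_Suc)
  ultimately show ?thesis
    using has_sum_reindex[of Suc UNIV "\<lambda>m. real m powr - s"] by (simp add: o_def)
qed

lemma zeta_pos: "s > 1 \<Longrightarrow> 0 < zeta s"
  using has_sum_strict_mono[OF has_sum_0_simp zeta_has_sum[of s], of 1] by simp

lemma summable_on_starts:
  fixes g :: "nat \<Rightarrow> real"
  assumes g: "\<And>u. 0 \<le> g u" and sum: "(\<lambda>u. real u * g u) summable_on UNIV"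
  shows "(\<lambda>p. g (lden p)) summable_on starts"
    and "(\<Sum>\<^sub>\<infinity>p\<in>starts. g (lden p)) \<le> (\<Sum>\<^sub>\<infinity>u. real u * g u)"
proof -
  let ?T = "SIGMA u:UNIV. {1..u :: nat}"
  have inner: "((\<lambda>v. g (fst (u, v))) has_sum real u * g u) {1..u}" for u
    by (intro has_sum_finiteI) auto
  have T: "((\<lambda>z. g (fst z)) has_sum (\<Sum>\<^sub>\<infinity>u. real u * g u)) ?T"
    by (rule has_sum_SigmaI[OF inner has_sum_infsum[OF sum] summable_on_SigmaI[OF inner sum]])
      (use g in auto)
  have subset: "den ` starts \<subseteq> ?T" by (auto simp: den_image_starts)
  have inj: "inj_on den starts" by (rule inj_on_subset[OF inj_den]) simp
  have "(\<lambda>z. g (fst z)) summable_on den ` starts"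
    by (rule summable_on_subset[OF has_sum_imp_summable[OF T] subset])
  thus summable: "(\<lambda>p. g (lden p)) summable_on starts"
    by (simp add: summable_on_reindex[OF inj] o_def)
  have "((\<lambda>z. g (fst z)) has_sum (\<Sum>\<^sub>\<infinity>p\<in>starts. g (lden p))) (den ` starts)"
    using has_sum_infsum[OF summable] by (simp add: has_sum_reindex[OF inj] o_def)
  thus "(\<Sum>\<^sub>\<infinity>p\<in>starts. g (lden p)) \<le> (\<Sum>\<^sub>\<infinity>u. real u * g u)"
    by (rule has_sum_mono'[OF _ T subset]) (use g in auto)
qed

lemma lden_powr_summable_on_starts:
  assumes "s > 2"
  shows "(\<lambda>p. real (lden p) powr - s) summable_on starts"
proof (rule summable_on_starts(1))
  have "real u * real u powr - s = real u powr - (s - 1)" for u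
    by (cases "u = 0") (simp_all add: powr_diff powr_minus field_simps)
  thus "(\<lambda>u. real u * real u powr - s) summable_on UNIV"
    using summable_on_powr_minus[of "s - 1"] assms by simp
qed auto

lemma den_prod_powr_summable:
  assumes "s > 1"
  shows "(\<lambda>w. den_prod w powr - s) summable_on UNIV"
proof -
  let ?g = "\<lambda>(u, v). real u powr - s * real v powr - s"
  have "?g summable_on UNIV \<times> UNIV"
    using has_sum_product_nonneg[OF has_sum_infsum _ has_sum_infsum,
        OF summable_on_powr_minus[OF assms] _ summable_on_powr_minus[OF assms]]
    by (intro has_sum_imp_summable) auto
  hence "?g summable_on range den" by (rule summable_on_subset) auto
  thus ?thesis
    by (simp add: summable_on_reindex[OF inj_den] o_def case_prod_unfold den_prod_def powr_mult)
qed

lemma powr_minus_Suc_le_diff: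
  assumes "s > 1" "x \<ge> 1"
  shows "real (Suc x) powr - s \<le> (real x powr (1 - s) - real (Suc x) powr (1 - s)) / (s - 1)"
proof -
  have "\<exists>z. real x < z \<and> z < real (Suc x) \<and> real (Suc x) powr (1 - s) - real x powr (1 - s)
     = (real (Suc x) - real x) * ((1 - s) * z powr (1 - s - 1))"
  proof (rule MVT2)
    show "((\<lambda>t. t powr (1 - s)) has_real_derivative (1 - s) * z powr (1 - s - 1)) (at z)"
      if "real x \<le> z" for z
      using that assms by (intro has_real_derivative_powr) auto
  qed simp
  then obtain z where z: "real x < z" "z < real (Suc x)"
    "real (Suc x) powr (1 - s) - real x powr (1 - s) = (1 - s) * z powr - s" by auto
  have "real (Suc x) powr - s \<le> z powr - s"
    using z assms by (intro powr_mono2') auto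
  also have "\<dots> = (real x powr (1 - s) - real (Suc x) powr (1 - s)) / (s - 1)"
    using z(3) assms by (simp add: field_simps)
  finally show ?thesis .
qed

lemma sum_powr_minus_tail_le:
  assumes "s > 1" "m \<ge> 1"
  shows "(\<Sum>u = Suc m..N. real u powr - s) \<le> real m powr (1 - s) / (s - 1)"
proof (cases "m \<le> N")
  case True
  hence "(\<Sum>u = Suc m..N. real u powr - s) \<le> (real m powr (1 - s) - real N powr (1 - s)) / (s - 1)"
  proof (induction N rule: dec_induct)
    case (step x)
    thus ?case
      using powr_minus_Suc_le_diff[of s x] assms by (simp add: diff_divide_distrib)
  qed simp
  also have "\<dots> \<le> real m powr (1 - s) / (s - 1)" using assms by (intro divide_right_mono) auto
  finally show ?thesis .
qed (use assms in simp)

lemma min_power_term_le_near: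
  assumes "s - 3 \<le> real J" "1 \<le> u" "u \<le> n"
  shows "real u * (real u powr - s * min_power (Suc J) J (2 * real u / real n))
    \<le> 2 ^ Suc J * real n powr (2 - s) * inverse (real u)"
proof -
  let ?K = "real (Suc J)"
  have "real u * (real u powr - s * min_power (Suc J) J (2 * real u / real n))
      \<le> real u * (real u powr - s * (2 * real u / real n) ^ Suc J)"
    by (intro mult_left_mono min_power_le) auto
  also have "\<dots> = 2 ^ Suc J * real n powr - ?K * (real u powr (?K + 2 - s) * inverse (real u))"
    using assms
    by (simp add: power_divide power_mult_distrib powr_diff powr_add powr_realpow powr_minus
        field_simps power3_eq_cube)
  also have "\<dots> \<le> 2 ^ Suc J * real n powr - ?K * (real n powr (?K + 2 - s) * inverse (real u))"
    using assms by (intro mult_left_mono mult_right_mono powr_mono2) auto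
  also have "\<dots> = 2 ^ Suc J * (real n powr - ?K * real n powr (?K + 2 - s)) * inverse (real u)"
    by (simp only: mult_ac)
  also have "real n powr - ?K * real n powr (?K + 2 - s) = real n powr (2 - s)"
    by (simp flip: powr_add)
  finally show ?thesis .
qed

lemma min_power_term_le_far:
  assumes "1 \<le> u" "1 \<le> n"
  shows "real u * (real u powr - s * min_power (Suc J) J (2 * real u / real n))
    \<le> 2 ^ J * real n powr - real J * real u powr - (s - 1 - real J)"
proof -
  have "real u * (real u powr - s * min_power (Suc J) J (2 * real u / real n))
      \<le> real u * (real u powr - s * (2 * real u / real n) ^ J)"
    by (intro mult_left_mono min_power_le) auto
  also have "\<dots> = 2 ^ J * real n powr - real J * real u powr - (s - 1 - real J)"
    using assms
    by (simp add: power_divide power_mult_distrib powr_diff powr_add powr_realpow powr_minus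
        field_simps)
  finally show ?thesis .
qed

lemma sum_min_power_le:
  assumes J_bounds: "s - 3 \<le> real J" "real J < s - 2" and n_pos: "1 \<le> n"
  defines "f \<equiv> \<lambda>u. real u * (real u powr - s * min_power (Suc J) J (2 * real u / real n))"
  shows "(\<Sum>u = 1..N. f u)
      \<le> 2 ^ Suc J * real n powr (2 - s) * (1 + ln (real n) + 1 / (s - 2 - real J))"
proof -
  define \<theta> where "\<theta> = s - 1 - real J"
  have "(\<Sum>u = 1..N. f u) \<le> (\<Sum>u\<in>{1..n} \<union> {Suc n..N}. f u)"
    by (intro sum_mono2) (auto simp: f_def min_power_nonneg)
  also have "\<dots> = (\<Sum>u = 1..n. f u) + (\<Sum>u = Suc n..N. f u)" by (intro sum.union_disjoint) auto
  also have "\<dots> \<le> (\<Sum>u = 1..n. 2 ^ Suc J * real n powr (2 - s) * inverse (real u))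
      + (\<Sum>u = Suc n..N. 2 ^ J * real n powr - real J * real u powr - \<theta>)"
    unfolding f_def \<theta>_def using J_bounds n_pos
    by (intro add_mono sum_mono min_power_term_le_near min_power_term_le_far) auto
  also have "\<dots> = 2 ^ Suc J * real n powr (2 - s) * harm n
      + 2 ^ J * real n powr - real J * (\<Sum>u = Suc n..N. real u powr - \<theta>)"
    by (simp add: harm_def sum_distrib_left)
  also have "\<dots> \<le> 2 ^ Suc J * real n powr (2 - s) * (1 + ln (real n))
      + 2 ^ Suc J * real n powr - real J * (real n powr (1 - \<theta>) / (\<theta> - 1))"
  proof (intro add_mono mult_left_mono mult_mono)
    show "harm n \<le> 1 + ln (real n)"
      using euler_mascheroni_sequence_decreasing[of 1 n] n_pos by (simp add: harm_def)
    show "(\<Sum>u = Suc n..N. real u powr - \<theta>) \<le> real n powr (1 - \<theta>) / (\<theta> - 1)"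
      using J_bounds n_pos by (intro sum_powr_minus_tail_le) (auto simp: \<theta>_def)
  qed (auto intro!: sum_nonneg)
  also have "\<dots> = 2 ^ Suc J * real n powr (2 - s) * (1 + ln (real n) + 1 / (s - 2 - real J))"
    using n_pos by (simp add: \<theta>_def algebra_simps flip: powr_add)
  finally show ?thesis .
qed

section \<open>Frames with the block at the end\<close>

definition lag :: "bool list \<Rightarrow> real" where
  "lag p = real (Suc (length p)) - real (rden p) / real (lden p)"

lemma lag_nonneg:
  assumes "p \<in> starts"
  shows "0 \<le> lag p"
proof -
  have "real (rden p) / real (lden p) \<le> 1" using rden_le_lden[OF assms] den_pos[of p] by simp
  thus ?thesis by (simp add: lag_def)
qed

lemma lag_le: "lag p \<le> real (Suc (length p))"
  by (simp add: lag_def)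

interpretation final:
  lag_family \<beta> starts "\<lambda>p. real (lden p) powr - (2 * \<beta>)" "\<lambda>p. Suc (length p)" lag "\<lambda>_. 0" for \<beta>
  by standard (use lag_nonneg lag_le in auto)

lemma den_replicate_append:
  "den (replicate a False @ p) = (lden p, rden p + a * lden p)"
  by (induction a) auto

lemma den_prod_fill_final:
  assumes "Suc (length p) \<le> n"
  shows "den_prod (fill n (p, [])) = real (lden p) ^ 2 * (real n - lag p)"
  using assms den_pos[of p]
  by (simp add: den_prod_def den_replicate_append lag_def of_nat_diff power2_eq_square field_simps)

lemma den_prod_fill_final_powr:
  assumes "Suc (length p) \<le> n"
  shows "den_prod (fill n (p, [])) powr - \<beta> = real n powr - \<beta> *
    (real (lden p) powr - (2 * \<beta>) * ((1 - lag p / real n) powr - \<beta> * (1 - 0 / real n) powr - \<beta>))"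
proof -
  have n: "0 < real n" using assms by simp
  have "den_prod (fill n (p, []))
      = (real (lden p) * real (lden p)) * (real n * (1 - lag p / real n))"
    unfolding den_prod_fill_final[OF assms] using n by (simp add: power2_eq_square field_simps)
  moreover have "0 \<le> 1 - lag p / real n"
    using lag_le[of p] assms n by simp
  ultimately show ?thesis using n by (simp add: powr_mult flip: powr_add)
qed

lemma den_prod_fill_final_powr_le:
  assumes "0 < A" "A \<le> real (n - Suc (length p))" "0 \<le> \<beta>"
  shows "den_prod (fill n (p, [])) powr - \<beta> \<le> A powr - \<beta> * real (lden p) powr - (2 * \<beta>)"
proof -
  have len: "Suc (length p) \<le> n" using assms(1,2) by linarith
  have u: "0 < real (lden p)" using den_pos by simp
  have "A \<le> real n - lag p" using lag_le[of p] assms(2) len by (simp add: of_nat_diff)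
  hence "real (lden p) ^ 2 * A \<le> den_prod (fill n (p, []))"
    unfolding den_prod_fill_final[OF len] by (intro mult_left_mono) auto
  hence "den_prod (fill n (p, [])) powr - \<beta> \<le> (real (lden p) ^ 2 * A) powr - \<beta>"
    using u assms by (intro powr_mono2') auto
  also have "\<dots> = A powr - \<beta> * real (lden p) powr - (2 * \<beta>)"
    using u assms(1) by (simp add: power2_eq_square powr_mult flip: powr_add)
  finally show ?thesis .
qed

lemma final_has_moment:
  assumes "real J < 2 * \<beta> - 2"
  shows "final.has_moment \<beta> J"
  unfolding final.has_moment_def
proof (rule summable_on_comparison_test)
  show "(\<lambda>p. real (lden p) powr - (2 * \<beta> - real J)) summable_on starts"
    using assms by (intro lden_powr_summable_on_starts) auto
  fix p assume p: "p \<in> starts"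
  have "real (lden p) powr - (2 * \<beta>) * real (Suc (length p)) ^ J \<le>
      real (lden p) powr - (2 * \<beta>) * real (lden p) ^ J"
    using length_less_lden[OF p] by (intro mult_left_mono power_mono) auto
  also have "\<dots> = real (lden p) powr - (2 * \<beta> - real J)"
    using den_pos[of p] by (simp add: powr_diff powr_minus powr_realpow field_simps)
  finally show "real (lden p) powr - (2 * \<beta>) * real (Suc (length p)) ^ J \<le>
      real (lden p) powr - (2 * \<beta> - real J)" .
qed auto

lemma final_truncation_error_le:
  assumes J_bounds: "2 * \<beta> - 3 \<le> real J" "real J < 2 * \<beta> - 2" and n_pos: "1 \<le> n"
  shows "final.truncation_error \<beta> (Suc J) J n \<le>
    2 ^ Suc J * real n powr (2 - 2 * \<beta>) * (1 + ln (real n) + 1 / (2 * \<beta> - 2 - real J))"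
    (is "_ \<le> ?B")
proof -
  define g where "g u = real u powr - (2 * \<beta>) * min_power (Suc J) J (2 * real u / real n)" for u
  have g: "0 \<le> g u" for u by (simp add: g_def min_power_nonneg)
  have partial: "(\<Sum>u\<in>F. real u * g u) \<le> ?B" if F: "finite F" for F
  proof -
    obtain N where "F \<subseteq> {..N}" using F finite_nat_iff_bounded_le by auto
    hence "(\<Sum>u\<in>F. real u * g u) \<le> (\<Sum>u\<le>N. real u * g u)"
      using g by (intro sum_mono2) auto
    also have "\<dots> = (\<Sum>u = 1..N. real u * g u)"
      by (intro sum.mono_neutral_right) (auto simp: not_less_eq_eq)
    also have "\<dots> \<le> ?B" unfolding g_def by (rule sum_min_power_le[OF J_bounds n_pos])
    finally show ?thesis .
  qed
  have sum: "(\<lambda>u. real u * g u) summable_on UNIV"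
    using g partial by (intro nonneg_bdd_above_summable_on bdd_aboveI2[of _ _ ?B]) auto
  have "final.truncation_error \<beta> (Suc J) J n \<le> (\<Sum>\<^sub>\<infinity>p\<in>starts. g (lden p))"
    unfolding final.truncation_error_def
  proof (rule infsum_mono[OF final.summable_truncation_error summable_on_starts(1)[OF g sum]])
    show "final.has_moment \<beta> J" using J_bounds by (intro final_has_moment)
    fix p assume "p \<in> starts"
    hence "real (Suc (length p)) \<le> real (lden p)" using length_less_lden by fastforce
    thus "real (lden p) powr - (2 * \<beta>) * min_power (Suc J) J (2 * real (Suc (length p)) / real n)
        \<le> g (lden p)"
      unfolding g_def by (auto intro!: mult_left_mono min_power_mono divide_right_mono)
  qed
  also have "\<dots> \<le> (\<Sum>\<^sub>\<infinity>u. real u * g u)" by (rule summable_on_starts(2)[OF g sum])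
  also have "\<dots> \<le> ?B" by (rule infsum_le_finite_sums[OF sum partial])
  finally show ?thesis .
qed

lemma final_coeff_pos:
  assumes "real k < 2 * \<beta> - 2"
  shows "0 < final.coeff \<beta> k"
  by (rule final.coeff_pos[of _ k _ "[True]"])
    (use assms final_has_moment in \<open>auto simp: starts_def lag_def\<close>)

lemma bij_betw_scaled_den:
  "bij_betw (\<lambda>(m, p). (m * lden p, m * rden p)) ({1..} \<times> starts) (SIGMA u:{1..}. {1..u})"
  (is "bij_betw ?f ?A ?B")
proof (rule bij_betw_imageI)
  show "inj_on ?f ?A"
  proof (rule inj_onI)
    fix x x' assume x: "x \<in> ?A" "x' \<in> ?A" "?f x = ?f x'"
    obtain m p m' p' where x_eq: "x = (m, p)" "x' = (m', p')" by fastforce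
    have eq: "m * lden p = m' * lden p'" "m * rden p = m' * rden p'" using x(3)
      by (simp_all add: x_eq)
    have "gcd (m * lden p) (m * rden p) = m" for m p
      using coprime_den[of p] by (simp add: gcd_mult_distrib_nat[symmetric])
    from this[of m p] this[of m' p'] have "m = m'" unfolding eq by simp
    moreover from this have "den p = den p'" using eq x(1) by (simp add: x_eq prod_eq_iff)
    ultimately show "x = x'" using inj_den by (simp add: x_eq inj_eq)
  qed
  show "?f ` ?A = ?B"
  proof (intro equalityI subsetI)
    fix z assume "z \<in> ?f ` ?A"
    then obtain m p where z: "z = (m * lden p, m * rden p)" "1 \<le> m" "p \<in> starts" by auto
    thus "z \<in> ?B" using rden_le_lden[OF z(3)] den_pos[of p] by (simp add: Suc_le_eq)
  next
    fix z assume "z \<in> ?B"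
    then obtain u v where z: "z = (u, v)" "1 \<le> v" "v \<le> u" by auto
    hence "gcd u v \<noteq> 0" by simp
    from gcd_coprime_exists[OF this] obtain u' v'
      where uv: "u = u' * gcd u v" "v = v' * gcd u v" "coprime u' v'" by blast
    have "1 \<le> v'" using uv(2) z(2) by (cases v') auto
    moreover have "v' \<le> u'" using uv(1,2) z(3) \<open>gcd u v \<noteq> 0\<close> by (metis mult_le_cancel2 gr0I)
    ultimately have "(u', v') \<in> den ` starts" using uv(3) by (simp add: den_image_starts)
    then obtain p where "p \<in> starts" "den p = (u', v')" by auto
    moreover have "1 \<le> gcd u v" using \<open>gcd u v \<noteq> 0\<close> by linarith
    ultimately show "z \<in> ?f ` ?A" using uv z(1)
      by (intro image_eqI[of _ _ "(gcd u v, p)"]) (auto simp: mult.commute)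
  qed
qed

lemma final_coeff_0:
  assumes "\<beta> > 1"
  shows "final.coeff \<beta> 0 = zeta (2 * \<beta> - 1) / zeta (2 * \<beta>)"
proof -
  have "((\<lambda>p. real (lden p) powr - (2 * \<beta>)) has_sum final.coeff \<beta> 0) starts"
    using lden_powr_summable_on_starts[of "2 * \<beta>"] assms by (simp add: final.coeff_def)
  from has_sum_product_nonneg[OF zeta_has_sum _ this, of "2 * \<beta>"] assms
  have "((\<lambda>(m, p). real m powr - (2 * \<beta>) * real (lden p) powr - (2 * \<beta>)) has_sum
      zeta (2 * \<beta>) * final.coeff \<beta> 0) ({1..} \<times> starts)" by simp
  hence "((\<lambda>z. real (fst z) powr - (2 * \<beta>))
      has_sum zeta (2 * \<beta>) * final.coeff \<beta> 0) (SIGMA u:{1..}. {1..u})"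
    by (subst has_sum_reindex_bij_betw[OF bij_betw_scaled_den, symmetric])
      (simp add: case_prod_unfold powr_mult)
  moreover have "((\<lambda>v. real (fst (u, v)) powr - (2 * \<beta>)) has_sum real u powr - (2 * \<beta> - 1)) {1..u}"
    if "u \<in> {1..}" for u
    using that by (intro has_sum_finiteI) (auto simp: powr_diff powr_minus field_simps)
  ultimately have "((\<lambda>u. real u powr - (2 * \<beta> - 1)) has_sum zeta (2 * \<beta>) * final.coeff \<beta> 0) {1..}"
    by (rule has_sum_SigmaD)
  hence "zeta (2 * \<beta>) * final.coeff \<beta> 0 = zeta (2 * \<beta> - 1)"
    using zeta_has_sum[of "2 * \<beta> - 1"] assms by (intro has_sum_unique) auto
  thus ?thesis using zeta_pos[of "2 * \<beta>"] assms by (simp add: field_simps)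
qed

section \<open>Frames with an inner block\<close>

fun left_lag :: "bool list \<times> bool list \<Rightarrow> real" where
  "left_lag (p, r) = lag p + (real (Suc (length r)) - real (fst (act r (1, 0))) / real (lden r))"

fun right_lag :: "bool list \<times> bool list \<Rightarrow> real" where
  "right_lag (p, r) = lag p + (real (Suc (length r)) - real (snd (act r (1, 0))) / real (rden r))"

lemma inner_lag_nonneg:
  assumes "p \<in> starts"
  shows "0 \<le> left_lag (p, r)" "0 \<le> right_lag (p, r)"
proof -
  have "real (fst (act r (1, 0))) / real (lden r) \<le> 1"
    "real (snd (act r (1, 0))) / real (rden r) \<le> 1"
    using act_one_zero_le[of r] den_pos[of r] by auto
  thus "0 \<le> left_lag (p, r)" "0 \<le> right_lag (p, r)" using lag_nonneg[OF assms] by simp_all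
qed

lemma inner_lag_le:
  "left_lag (p, r) \<le> real (frame_length (inner_frame (p, r)))"
  "right_lag (p, r) \<le> real (frame_length (inner_frame (p, r)))"
proof -
  have "real (frame_length (inner_frame (p, r))) = real (Suc (length p)) + real (Suc (length r))"
    by simp
  moreover have "0 \<le> real (fst (act r (1, 0))) / real (lden r)"
    "0 \<le> real (snd (act r (1, 0))) / real (rden r)"
    by auto
  ultimately show "left_lag (p, r) \<le> real (frame_length (inner_frame (p, r)))"
    "right_lag (p, r) \<le> real (frame_length (inner_frame (p, r)))"
    using lag_le[of p] unfolding left_lag.simps right_lag.simps by linarith+
qed

fun inner_weight :: "real \<Rightarrow> bool list \<times> bool list \<Rightarrow> real" where
  "inner_weight \<beta> (p, r) = real (lden p) powr - (2 * \<beta>) * den_prod r powr - \<beta>"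

interpretation inner:
  lag_family \<beta> "starts \<times> UNIV" "inner_weight \<beta>"
    "\<lambda>z. frame_length (inner_frame z)" left_lag right_lag
  for \<beta>
proof
  fix z :: "bool list \<times> bool list" assume "z \<in> starts \<times> UNIV"
  then obtain p r where z: "z = (p, r)" "p \<in> starts" by auto
  show "0 \<le> left_lag z" "0 \<le> right_lag z" unfolding z(1) by (rule inner_lag_nonneg[OF z(2)])+
  show "left_lag z \<le> real (frame_length (inner_frame z))"
    "right_lag z \<le> real (frame_length (inner_frame z))"
    unfolding z(1) by (rule inner_lag_le)+
  show "0 \<le> inner_weight \<beta> z" "0 < frame_length (inner_frame z)" by (simp_all add: z(1))
qed

lemma den_fill_inner:
  fixes p r a
  defines "y \<equiv> rden p + a * lden p"
  shows "den (r @ True # replicate a False @ p) =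
    (lden r * y + fst (act r (1, 0)) * lden p, rden r * y + snd (act r (1, 0)) * lden p)"
proof -
  have "den (r @ True # replicate a False @ p) = act r (den (True # replicate a False @ p))"
    unfolding den_def by (rule act_append)
  also have "den (True # replicate a False @ p) = (lden p + y, y)"
    by (simp add: den_replicate_append y_def)
  finally show ?thesis
    using act_linear[of r "lden p + y" y] act_linear[of r 1 1] by (simp add: den_def algebra_simps)
qed

lemma den_prod_fill_inner:
  assumes "frame_length (inner_frame (p, r)) \<le> n"
  shows "den_prod (fill n (inner_frame (p, r))) =
    real (lden p) ^ 2 * den_prod r * ((real n - left_lag (p, r)) * (real n - right_lag (p, r)))"
proof -
  define a where "a = n - frame_length (inner_frame (p, r))"
  have a: "real a = real n - real (Suc (length p)) - real (Suc (length r))"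
    using assms by (simp add: a_def of_nat_diff)
  define left where "left = real (lden r) * (real (rden p) + real a * real (lden p)) +
    real (fst (act r (1, 0))) * real (lden p)"
  define right where "right = real (rden r) * (real (rden p) + real a * real (lden p)) +
    real (snd (act r (1, 0))) * real (lden p)"
  have "left = real (lden r) * real (lden p) * (real n - left_lag (p, r))"
    "right = real (rden r) * real (lden p) * (real n - right_lag (p, r))"
    unfolding left_def right_def a using den_pos[of p] den_pos[of r]
    by (simp_all add: lag_def field_simps)
  moreover have "fill n (inner_frame (p, r)) = r @ True # replicate a False @ p"
    by (simp add: a_def)
  hence "den_prod (fill n (inner_frame (p, r))) = left * right"
    by (simp add: den_prod_def den_fill_inner left_def right_def)
  ultimately show ?thesis by (simp only: den_prod_def power2_eq_square mult_ac)
qed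

lemma den_prod_fill_inner_powr:
  assumes "frame_length (inner_frame z) \<le> n"
  shows "den_prod (fill n (inner_frame z)) powr - \<beta> = real n powr - (2 * \<beta>) *
    (inner_weight \<beta> z * ((1 - left_lag z / real n) powr - \<beta> * (1 - right_lag z / real n) powr - \<beta>))"
proof -
  obtain p r where z: "z = (p, r)" by fastforce
  define x y where "x = 1 - left_lag z / real n" and "y = 1 - right_lag z / real n"
  have n: "0 < real n" using assms by (simp add: z)
  have "left_lag z \<le> real n" "right_lag z \<le> real n"
    using inner_lag_le[of p r] assms unfolding z by linarith+
  hence nonneg: "0 \<le> x" "0 \<le> y" using n by (simp_all add: x_def y_def)
  have "real n - left_lag z = real n * x" "real n - right_lag z = real n * y"
    using n by (simp_all add: x_def y_def field_simps)
  hence "den_prod (fill n (inner_frame z)) =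
      (real n * real n) * ((real (lden p) * real (lden p)) * den_prod r * (x * y))"
    using den_prod_fill_inner[of p r n] assms unfolding z
    by (simp only: power2_eq_square mult_ac)
  thus ?thesis unfolding x_def[symmetric] y_def[symmetric]
    using n nonneg den_prod_pos[of r] by (simp add: z powr_mult flip: powr_add)
qed

lemma den_prod_fill_inner_powr_le:
  assumes "0 < A" "A \<le> real (n - frame_length (inner_frame z))" "0 \<le> \<beta>"
  shows "den_prod (fill n (inner_frame z)) powr - \<beta> \<le> A powr - (2 * \<beta>) * inner_weight \<beta> z"
proof -
  obtain p r where z: "z = (p, r)" by fastforce
  have len: "frame_length (inner_frame (p, r)) \<le> n" using assms(1,2) unfolding z by linarith
  have pos: "0 < real (lden p)" "0 < den_prod r" using den_pos den_prod_pos by simp_all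
  have "A \<le> real n - left_lag (p, r)" "A \<le> real n - right_lag (p, r)"
    using inner_lag_le[of p r] assms(2) unfolding z of_nat_diff[OF len] by linarith+
  hence "A * A \<le> (real n - left_lag (p, r)) * (real n - right_lag (p, r))"
    using assms(1) by (intro mult_mono) auto
  hence "real (lden p) ^ 2 * den_prod r * (A * A) \<le> den_prod (fill n (inner_frame z))"
    unfolding z den_prod_fill_inner[OF len] using pos by (intro mult_left_mono) auto
  hence "den_prod (fill n (inner_frame z)) powr - \<beta>
      \<le> (real (lden p) ^ 2 * den_prod r * (A * A)) powr - \<beta>"
    using pos assms by (intro powr_mono2') auto
  also have "\<dots> = A powr - (2 * \<beta>) * inner_weight \<beta> z"
    using pos assms(1) by (simp add: z power2_eq_square powr_mult flip: powr_add)
  finally show ?thesis .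
qed

lemma inner_has_moment:
  assumes "real K < \<beta> - 1"
  shows "inner.has_moment \<beta> K"
  unfolding inner.has_moment_def
proof (rule summable_on_comparison_test)
  let ?f = "\<lambda>(p, r). real (lden p) powr - (2 * \<beta> - real K) * den_prod r powr - (\<beta> - real K)"
  have "?f summable_on starts \<times> UNIV"
    using assms has_sum_product_nonneg[OF has_sum_infsum _ has_sum_infsum,
        OF lden_powr_summable_on_starts[of "2 * \<beta> - real K"] _
          den_prod_powr_summable[of "\<beta> - real K"]]
    by (intro has_sum_imp_summable) auto
  thus "(\<lambda>z. 2 ^ K * ?f z) summable_on starts \<times> UNIV" by (rule summable_on_cmult_right)
  fix z :: "bool list \<times> bool list" assume z_in: "z \<in> starts \<times> UNIV"
  then obtain p r where z: "z = (p, r)" "p \<in> starts" by auto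
  have pos: "0 < real (lden p)" "0 < den_prod r" using den_pos den_prod_pos by simp_all
  have "frame_length (inner_frame z) \<le> 2 * (Suc (length p) * Suc (length r))" by (simp add: z)
  hence "real (frame_length (inner_frame z)) \<le> 2 * (real (Suc (length p)) * real (Suc (length r)))"
    by (metis of_nat_le_iff of_nat_mult of_nat_numeral)
  also have "\<dots> \<le> 2 * (real (lden p) * den_prod r)"
    using length_less_lden[OF z(2)] Suc_length_le_den_prod[of r]
    by (intro mult_left_mono mult_mono) auto
  finally have "inner_weight \<beta> z * real (frame_length (inner_frame z)) ^ K
      \<le> inner_weight \<beta> z * (2 * (real (lden p) * den_prod r)) ^ K"
    by (intro mult_left_mono power_mono inner.weight_nonneg[OF z_in]) auto
  also have "\<dots> = 2 ^ K * ?f z"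
    using pos by (simp add: z power_mult_distrib powr_diff powr_minus powr_realpow field_simps)
  finally show "inner_weight \<beta> z * real (frame_length (inner_frame z)) ^ K \<le> 2 ^ K * ?f z" .
qed auto

lemma inner_truncation_error_eq:
  "inner.truncation_error \<beta> K K n = inner.truncation_error \<beta> K K 1 * (1 / real n ^ K)"
proof -
  have "c * min_power K K (2 * real m / real n)
      = c * min_power K K (2 * real m / real 1) * (1 / real n ^ K)"
    for c m by (simp add: min_power_def power_divide)
  thus ?thesis by (simp only: inner.truncation_error_def infsum_cmult_left')
qed

lemma inner_coeff_pos:
  assumes "real k < \<beta> - 1"
  shows "0 < inner.coeff \<beta> k"
  by (rule inner.coeff_pos[of _ k _ "([True], [])"])
    (use assms inner_has_moment in \<open>auto simp: starts_def lag_def den_prod_def\<close>)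

section \<open>The expansion\<close>

lemma short_frames_expansion:
  assumes \<beta>_gt_1: "1 < \<beta>" and J_less: "real J < 2 * \<beta> - 2" and K_less: "real K < \<beta> - 1"
    and n_pos: "1 \<le> n"
  shows "\<bar>(\<Sum>x\<in>short_frames n. den_prod (fill n x) powr - \<beta>) -
      ((\<Sum>k<Suc J. final.coeff \<beta> k / real n powr (\<beta> + real k)) +
       (\<Sum>k<K. inner.coeff \<beta> k / real n powr (2 * \<beta> + real k)))\<bar> \<le>
    4 powr \<beta> * (real n powr - \<beta> * final.truncation_error \<beta> (Suc J) J n +
      real n powr - (2 * \<beta>) * inner.truncation_error \<beta> K K n)"
proof -
  let ?f = "\<lambda>x. den_prod (fill n x) powr - \<beta>"
  let ?final = "{p \<in> starts. 2 * Suc (length p) \<le> n}"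
  let ?inner = "{z \<in> starts \<times> UNIV. 2 * frame_length (inner_frame z) \<le> n}"
  have "finite {m. 2 * m \<le> n}" by (rule finite_subset[of _ "{..n}"]) auto
  from sum_frames_split[OF this, of ?f]
  have "(\<Sum>x\<in>short_frames n. ?f x) = (\<Sum>p\<in>?final. ?f (p, [])) + (\<Sum>z\<in>?inner. ?f (inner_frame z))"
    by (simp only: short_frames_def)
  moreover have "\<bar>(\<Sum>p\<in>?final. ?f (p, [])) - (\<Sum>k<Suc J. final.coeff \<beta> k / real n powr (\<beta> + real k))\<bar>
      \<le> 4 powr \<beta> * (real n powr - \<beta> * final.truncation_error \<beta> (Suc J) J n)"
  proof (rule final.sum_short_expansion)
    show "finite ?final" by (rule finite_subset[OF _ finite_words_length_le[of n]]) auto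
  qed (use \<beta>_gt_1 n_pos J_less final_has_moment den_prod_fill_final_powr in auto)
  moreover have "\<bar>(\<Sum>z\<in>?inner. ?f (inner_frame z)) -
        (\<Sum>k<K. inner.coeff \<beta> k / real n powr (2 * \<beta> + real k))\<bar>
      \<le> 4 powr \<beta> * (real n powr - (2 * \<beta>) * inner.truncation_error \<beta> K K n)"
  proof (rule inner.sum_short_expansion)
    show "finite ?inner" by (rule finite_subset[OF _ finite_inner_frames[of n]]) auto
  qed (use \<beta>_gt_1 n_pos K_less inner_has_moment den_prod_fill_inner_powr in auto)
  ultimately show ?thesis unfolding distrib_left by linarith
qed

lemma sum_long_frames_le:
  assumes \<beta>_gt_1: "1 < \<beta>" and J_less: "real J < 2 * \<beta> - 2" and K_less: "real K < \<beta> - 1"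
    and n_pos: "1 \<le> n" and A_pos: "0 < A"
  shows "(\<Sum>x\<in>long_frames A n. den_prod (fill n x) powr - \<beta>) \<le>
    A powr - \<beta> * final.truncation_error \<beta> (Suc J) J n +
    A powr - (2 * \<beta>) * inner.truncation_error \<beta> K K n"
proof -
  let ?f = "\<lambda>x. den_prod (fill n x) powr - \<beta>"
  let ?long = "\<lambda>m. n < 2 * m \<and> A \<le> real (n - m)"
  let ?final = "{p \<in> starts. ?long (Suc (length p))}"
  let ?inner = "{z \<in> starts \<times> UNIV. ?long (frame_length (inner_frame z))}"
  have "finite {m. ?long m}" by (rule finite_subset[of _ "{..n}"]) (use A_pos in auto)
  from sum_frames_split[OF this, of ?f]
  have "(\<Sum>x\<in>long_frames A n. ?f x) = (\<Sum>p\<in>?final. ?f (p, [])) + (\<Sum>z\<in>?inner. ?f (inner_frame z))"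
    by (simp only: long_frames_def)
  also have "(\<Sum>p\<in>?final. ?f (p, [])) \<le> A powr - \<beta> * final.truncation_error \<beta> (Suc J) J n"
  proof (rule final.sum_long_le_truncation_error)
    show "finite ?final"
      by (rule finite_subset[OF _ finite_words_length_le[of n]]) (use A_pos in auto)
  qed (use \<beta>_gt_1 n_pos J_less A_pos final_has_moment den_prod_fill_final_powr_le[of A n _ \<beta>]
      in auto)
  also have "(\<Sum>z\<in>?inner. ?f (inner_frame z)) \<le> A powr - (2 * \<beta>) * inner.truncation_error \<beta> K K n"
  proof (rule inner.sum_long_le_truncation_error)
    show "finite ?inner" by (rule finite_subset[OF _ finite_inner_frames[of n]]) (use A_pos in auto)
  qed (use \<beta>_gt_1 n_pos K_less A_pos inner_has_moment den_prod_fill_inner_powr_le[of A n _ \<beta>]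
      in auto)
  finally show ?thesis by simp
qed

lemma brocot_sigma_expansion:
  assumes \<beta>_gt_1: "1 < \<beta>" and J_less: "real J < 2 * \<beta> - 2" and K_less: "real K < \<beta> - 1"
    and n_pos: "1 \<le> n" and A_bounds: "0 < A" "A \<le> real n"
  shows "\<bar>brocot_sigma \<beta> n - 2 * ((\<Sum>k<Suc J. final.coeff \<beta> k / real n powr (\<beta> + real k)) +
       (\<Sum>k<K. inner.coeff \<beta> k / real n powr (2 * \<beta> + real k)))\<bar> \<le>
    (2 + 2 * 4 powr \<beta>) * (A powr - \<beta> * final.truncation_error \<beta> (Suc J) J n +
      A powr - (2 * \<beta>) * inner.truncation_error \<beta> K K n) +
    2 powr - (((real n - 1) / A - 1) * (\<beta> - 1))"
proof -
  define short where "short = (\<Sum>x\<in>short_frames n. den_prod (fill n x) powr - \<beta>)"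
  define long where "long = (\<Sum>x\<in>long_frames A n. den_prod (fill n x) powr - \<beta>)"
  define main where "main = (\<Sum>k<Suc J. final.coeff \<beta> k / real n powr (\<beta> + real k)) +
    (\<Sum>k<K. inner.coeff \<beta> k / real n powr (2 * \<beta> + real k))"
  define error where "error B = B powr - \<beta> * final.truncation_error \<beta> (Suc J) J n +
    B powr - (2 * \<beta>) * inner.truncation_error \<beta> K K n" for B
  have "error (real n) \<le> error A"
    unfolding error_def using A_bounds \<beta>_gt_1
    by (intro add_mono mult_right_mono powr_mono2' final.truncation_error_nonneg
        inner.truncation_error_nonneg) auto
  hence "4 powr \<beta> * error (real n) \<le> 4 powr \<beta> * error A" by (intro mult_left_mono) auto
  hence "\<bar>short - main\<bar> \<le> 4 powr \<beta> * error A"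
    using short_frames_expansion[OF \<beta>_gt_1 J_less K_less n_pos]
    unfolding short_def main_def error_def by linarith
  moreover have "long \<le> error A"
    unfolding long_def error_def
    by (rule sum_long_frames_le[OF \<beta>_gt_1 J_less K_less n_pos A_bounds(1)])
  moreover have "\<bar>brocot_sigma \<beta> n - 2 * short\<bar>
      \<le> 2 powr - (((real n - 1) / A - 1) * (\<beta> - 1)) + 2 * long"
    using brocot_sigma_short_frames[of \<beta> n A] \<beta>_gt_1 n_pos A_bounds(1)
    by (simp add: short_def long_def of_nat_diff)
  ultimately have "\<bar>brocot_sigma \<beta> n - 2 * main\<bar> \<le>
      2 * error A + 2 * (4 powr \<beta> * error A) + 2 powr - (((real n - 1) / A - 1) * (\<beta> - 1))"
    by linarith
  thus ?thesis unfolding main_def error_def by (simp only: distrib_right mult.assoc)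
qed

lemma final_truncation_error_bigo:
  assumes J_bounds: "2 * \<beta> - 3 \<le> real J" "real J < 2 * \<beta> - 2"
  shows "final.truncation_error \<beta> (Suc J) J \<in> O(\<lambda>n. real n powr (2 - 2 * \<beta>) * ln (real n))"
proof -
  define D where "D = 1 / (2 * \<beta> - 2 - real J)"
  have "norm (final.truncation_error \<beta> (Suc J) J n) \<le>
      2 ^ Suc J * norm (real n powr (2 - 2 * \<beta>) * (1 + ln (real n) + D))" if n: "1 \<le> n" for n
  proof -
    have "0 < D" using J_bounds by (simp add: D_def)
    thus ?thesis
      using final_truncation_error_le[OF J_bounds n]
        final.truncation_error_nonneg[of \<beta> "Suc J" J n] n
      by (simp add: D_def mult.assoc)
  qed
  hence "final.truncation_error \<beta> (Suc J) J
      \<in> O(\<lambda>n. real n powr (2 - 2 * \<beta>) * (1 + ln (real n) + D))"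
    by (intro bigoI eventually_mono[OF eventually_ge_at_top[of 1]])
  also have "(\<lambda>n. real n powr (2 - 2 * \<beta>) * (1 + ln (real n) + D))
      \<in> O(\<lambda>n. real n powr (2 - 2 * \<beta>) * ln (real n))"
    by real_asymp
  finally show ?thesis .
qed

lemma inner_truncation_error_bigo:
  "inner.truncation_error \<beta> K K \<in> O(\<lambda>n. real n powr - real K)"
proof (rule bigoI)
  show "\<forall>\<^sub>F n in sequentially. norm (inner.truncation_error \<beta> K K n) \<le>
      inner.truncation_error \<beta> K K 1 * norm (real n powr - real K)"
    using eventually_gt_at_top[of 0]
  proof eventually_elim
    case (elim n)
    hence "1 / real n ^ K = real n powr - real K" by (simp add: powr_minus powr_realpow field_simps)
    thus ?case
      using inner_truncation_error_eq[of \<beta> K n] inner.truncation_error_nonneg[of \<beta> K K n] by simp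
  qed
qed

definition cutoff :: "real \<Rightarrow> nat \<Rightarrow> real" where
  "cutoff c n = real n / (c * ln (real n))"

lemma cutoff_final_error_bigo:
  assumes "1 < \<beta>" "0 < c" "2 * \<beta> - 3 \<le> real J" "real J < 2 * \<beta> - 2"
  shows "(\<lambda>n. cutoff c n powr - \<beta> * final.truncation_error \<beta> (Suc J) J n)
    \<in> O(\<lambda>n. ln (real n) powr (3 * \<beta>) / real n powr (3 * \<beta> - 2))"
proof -
  have "(\<lambda>n. cutoff c n powr - \<beta> * final.truncation_error \<beta> (Suc J) J n)
      \<in> O(\<lambda>n. cutoff c n powr - \<beta> * (real n powr (2 - 2 * \<beta>) * ln (real n)))"
    using assms by (intro landau_o.big.mult_left final_truncation_error_bigo)
  also have "(\<lambda>n. cutoff c n powr - \<beta> * (real n powr (2 - 2 * \<beta>) * ln (real n)))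
      \<in> O(\<lambda>n. ln (real n) powr (3 * \<beta>) / real n powr (3 * \<beta> - 2))"
    unfolding cutoff_def using assms by real_asymp
  finally show ?thesis .
qed

lemma cutoff_inner_error_bigo:
  assumes "1 < \<beta>" "0 < c" "\<beta> - 2 \<le> real K"
  shows "(\<lambda>n. cutoff c n powr - (2 * \<beta>) * inner.truncation_error \<beta> K K n)
    \<in> O(\<lambda>n. ln (real n) powr (3 * \<beta>) / real n powr (3 * \<beta> - 2))"
proof -
  have "(\<lambda>n. real n powr - real K) \<in> O(\<lambda>n. real n powr (2 - \<beta>))"
    using assms(3)
    by (intro bigoI[of _ 1] eventually_mono[OF eventually_ge_at_top[of 1]]) (auto intro: powr_mono)
  hence "(\<lambda>n. cutoff c n powr - (2 * \<beta>) * inner.truncation_error \<beta> K K n)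
      \<in> O(\<lambda>n. cutoff c n powr - (2 * \<beta>) * real n powr (2 - \<beta>))"
    by (intro landau_o.big.mult_left landau_o.big_trans[OF inner_truncation_error_bigo])
  also have "(\<lambda>n. cutoff c n powr - (2 * \<beta>) * real n powr (2 - \<beta>))
      \<in> O(\<lambda>n. ln (real n) powr (3 * \<beta>) / real n powr (3 * \<beta> - 2))"
    unfolding cutoff_def using assms by real_asymp
  finally show ?thesis .
qed

lemma brocot_sigma_expansion_bigo:
  assumes \<beta>_gt_1: "1 < \<beta>" and J_bounds: "2 * \<beta> - 3 \<le> real J" "real J < 2 * \<beta> - 2"
    and K_bounds: "\<beta> - 2 \<le> real K" "real K < \<beta> - 1"
  shows "(\<lambda>n. brocot_sigma \<beta> n - 2 * ((\<Sum>k<Suc J. final.coeff \<beta> k / real n powr (\<beta> + real k)) +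
      (\<Sum>k<K. inner.coeff \<beta> k / real n powr (2 * \<beta> + real k))))
    \<in> O(\<lambda>n. ln (real n) powr (3 * \<beta>) / real n powr (3 * \<beta> - 2))" (is "?f \<in> O(?g)")
proof -
  \<comment> \<open>With this \<open>c\<close> the words with many blocks contribute \<open>O(n powr - (3 * \<beta>))\<close>.\<close>
  define c where "c = 3 * \<beta> / ((\<beta> - 1) * ln 2)"
  have c_pos: "0 < c" using \<beta>_gt_1 by (simp add: c_def)
  define many where "many n = 2 powr - (((real n - 1) / cutoff c n - 1) * (\<beta> - 1))" for n
  define bound where "bound n = (2 + 2 * 4 powr \<beta>) *
    (cutoff c n powr - \<beta> * final.truncation_error \<beta> (Suc J) J n +
     cutoff c n powr - (2 * \<beta>) * inner.truncation_error \<beta> K K n) + many n" for n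
  have "eventually (\<lambda>n. 0 < cutoff c n) sequentially"
    "eventually (\<lambda>n. cutoff c n \<le> real n) sequentially"
    unfolding cutoff_def using c_pos by real_asymp+
  hence "eventually (\<lambda>n. norm (?f n) \<le> 1 * norm (bound n)) sequentially"
    using eventually_ge_at_top[of 1]
  proof eventually_elim
    case (elim n)
    have "norm (?f n) \<le> bound n"
      using brocot_sigma_expansion[OF \<beta>_gt_1 J_bounds(2) K_bounds(2) elim(3,1,2)]
      by (simp only: bound_def many_def real_norm_def)
    thus ?case by simp
  qed
  hence "?f \<in> O(bound)" by (rule bigoI)
  also have "bound \<in> O(?g)"
  proof -
    have "many \<in> O(?g)"
      unfolding many_def cutoff_def c_def using \<beta>_gt_1 by real_asymp
    thus ?thesis
      unfolding bound_def using \<beta>_gt_1 c_pos J_bounds K_bounds(1)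
      by (intro sum_in_bigo cmult_in_bigo_iff[THEN iffD2] disjI2
          cutoff_final_error_bigo cutoff_inner_error_bigo)
  qed
  finally show ?thesis .
qed

lemma real_less_iff_less_nat_ceiling: "real k < x \<longleftrightarrow> k < nat \<lceil>x\<rceil>"
  unfolding zless_nat_eq_int_zless less_ceiling_iff by simp

theorem theorem2:
  fixes \<beta> :: real
  assumes "\<beta> > 1"
  shows "\<exists>C C' :: nat \<Rightarrow> real.
    (\<forall>k. 1 \<le> k \<and> real k < 2 * \<beta> - 2 \<longrightarrow> C k > 0) \<and>
    (\<forall>k. real k < \<beta> - 2 \<longrightarrow> C' k > 0) \<and>
    (\<lambda>n. brocot_sigma \<beta> n -
        (1 / real n powr \<beta> * (2 * zeta (2 * \<beta> - 1) / zeta (2 * \<beta>))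
         + (\<Sum>k | 1 \<le> k \<and> real k < 2 * \<beta> - 2. C k * (1 / real n powr (\<beta> + real k)))
         + (\<Sum>k | real k < \<beta> - 2. C' k * (1 / real n powr (2 * \<beta> + real k)))))
      \<in> O(\<lambda>n. ln (real n) powr (3 * \<beta>) / real n powr (3 * \<beta> - 2))"
proof (intro exI conjI allI impI)
  define J K where "J = nat \<lceil>2 * \<beta> - 2\<rceil> - 1" and "K = nat \<lceil>\<beta> - 2\<rceil>"
  have J_iff: "real k < 2 * \<beta> - 2 \<longleftrightarrow> k < Suc J" for k
    using assms by (simp add: J_def real_less_iff_less_nat_ceiling)
  have K_iff: "real k < \<beta> - 2 \<longleftrightarrow> k < K" for k by (simp add: K_def real_less_iff_less_nat_ceiling)
  have J: "2 * \<beta> - 3 \<le> real J" "real J < 2 * \<beta> - 2" using J_iff[of "Suc J"] J_iff[of J] by auto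
  have K: "\<beta> - 2 \<le> real K" "real K < \<beta> - 1"
    using K_iff[of K] K_iff[of "K - 1"] assms by (auto simp: of_nat_diff)
  show "0 < 2 * final.coeff \<beta> k" if "1 \<le> k \<and> real k < 2 * \<beta> - 2" for k
    using that final_coeff_pos assms by simp
  show "0 < 2 * inner.coeff \<beta> k" if "real k < \<beta> - 2" for k
    using that inner_coeff_pos assms by simp
  have "{k. 1 \<le> k \<and> real k < 2 * \<beta> - 2} = {1..J}" "{k. real k < \<beta> - 2} = {..<K}"
    by (auto simp: J_iff K_iff)
  thus "(\<lambda>n. brocot_sigma \<beta> n - (1 / real n powr \<beta> * (2 * zeta (2 * \<beta> - 1) / zeta (2 * \<beta>))
         + (\<Sum>k | 1 \<le> k \<and> real k < 2 * \<beta> - 2. 2 * final.coeff \<beta> k * (1 / real n powr (\<beta> + real k)))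
         + (\<Sum>k | real k < \<beta> - 2. 2 * inner.coeff \<beta> k * (1 / real n powr (2 * \<beta> + real k)))))
      \<in> O(\<lambda>n. ln (real n) powr (3 * \<beta>) / real n powr (3 * \<beta> - 2))"
    using brocot_sigma_expansion_bigo[OF assms J K] final_coeff_0[OF assms]
    by (simp add: sum.lessThan_Suc_shift sum.atLeast1_atMost_eq sum_distrib_left algebra_simps
        del: sum.lessThan_Suc)
qed

end
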